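(* (1) There exists a sequence $\{a_n\}_{n\in\mathbb{Z}}$ of complex numbers such that the trigonometric series $\sum_{n=-\infty}^{\infty} a_n z^n$ is pointwise universal and $a_n=O\bigl(e^{|n|(\ln|n|)^{-1}}\bigr)$ as $|n|\to\infty$. (2) On the other hand, for each $\varepsilon>0$ and any sequence $\{a_n\}_{n\in\mathbb{Z}}$ of complex numbers satisfying $a_n=O\bigl(e^{|n|(\ln|n|)^{-1-\varepsilon}}\bigr)$ as $|n|\to\infty$, the trigonometric series $\sum_{n=-\infty}^{\infty} a_n z^n$ is not pointwise universal.
   Context: $\mathbb{T}=\{z\in\mathbb{C}:|z|=1\}$ and $C(\mathbb{T})$ is the space of continuous complex-valued functions on $\mathbb{T}$. A trigonometric series $\sum_{n=-\infty}^\infty a_n z^n$ is called pointwise universal if for every $f\in C(\mathbb{T})$ there exists a strictly increasing sequence $\{n_k\}_{k\in\mathbb{N}}$ of positive integers such that $\sum_{j=-n_k}^{n_k} a_j z^j$ converges to $f(z)$ as $k\to\infty$ for every $z\in\mathbb{T}$. *)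

theory Defs
  imports "HOL-Analysis.Analysis" "HOL-Library.Landau_Symbols"
begin

definition trig_partial_sum :: "(int \<Rightarrow> complex) \<Rightarrow> nat \<Rightarrow> complex \<Rightarrow> complex" where
  "trig_partial_sum a n z = (\<Sum>j\<in>{- int n..int n}. a j * z powi j)"

text \<open>A function in $C(\mathbb{T})$ is represented by a function on all complex numbers that is
  continuous on the unit circle; its values off the circle play no role.\<close>

definition pointwise_universal :: "(int \<Rightarrow> complex) \<Rightarrow> bool" where
  "pointwise_universal a \<longleftrightarrow>
     (\<forall>f :: complex \<Rightarrow> complex. continuous_on (sphere 0 1) f \<longrightarrow>
        (\<exists>n :: nat \<Rightarrow> nat. strict_mono n \<and> (\<forall>k. n k > 0) \<and>
           (\<forall>z\<in>sphere 0 1. (\<lambda>k. trig_partial_sum a (n k) z) \<longlonglongrightarrow> f z)))"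

definition int_abs_at_top :: "int filter" where
  "int_abs_at_top = filtercomap abs at_top"

end

theory Submission
  imports Defs "HOL-Computational_Algebra.Polynomial" "HOL-Real_Asymp.Real_Asymp"
begin

text \<open>
  Existence. Put \<open>W n = exp (\<bar>n\<bar> / ln (\<bar>n\<bar> + 3))\<close>. The series is built in blocks: each block corrects
  the current partial sum to a given trigonometric polynomial \<open>g\<close> outside a small arc, using only new
  frequencies and coefficients below \<open>W\<close>. The arcs are chosen so that each point lies in only finitely
  many of them. Such a correction has the form \<open>g (1 - P)\<close>, with the low frequencies dropped, where
  \<open>P\<close> is tiny outside the arc and its coefficients differ from those of the constant 1 by at most
  \<open>\<epsilon> W\<close>. To find \<open>P\<close>, approximate every translate \<open>exp (\<i> n H)\<close> of the point mass, in the norm weighted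
  by \<open>W\<close>, by combinations of point masses near 0: write \<open>H\<close> as a sum of steps of length about \<open>c / j\<close>
  (possible as the harmonic series diverges) and replace step \<open>j\<close> by its binomial expansion cut off
  at degree \<open>2 ^ j\<close>. Averaging over all \<open>H\<close> turns the translates into the constant 1, and
  convolution with a Fejer kernel turns the point masses into a trigonometric polynomial.

  Non-existence. Suppose that subsequences of the partial sums converge to 0 and to 1. By Baire both
  are bounded on a common interval. Repeated averaging over short intervals multiplies the
  coefficients by factors \<open>sin (j d) / (j d)\<close>; as \<open>ln n powr (- 1 - \<epsilon>) / n\<close> is summable, averages of arbitrarily
  small total length make the coefficients absolutely summable, so the averaged partial sums have a
  single limit at the midpoint, while dominated convergence makes it both 0 and 1.
\<close>

subsection \<open>Weighted approximation of translates by point masses\<close>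

text \<open>The shift by 3 keeps the logarithm at least 1, so that no frequency has to be treated
  separately.\<close>
definition weight :: "int \<Rightarrow> real" where
  "weight n = exp (real_of_int \<bar>n\<bar> / ln (real_of_int \<bar>n\<bar> + 3))"

lemma ln_add_3_ge_1: "ln (t + 3) \<ge> 1" if "t \<ge> 0" for t :: real
proof -
  have "ln (exp 1) \<le> ln (t + 3)"
    using that exp_le by (subst ln_le_cancel_iff) auto
  thus ?thesis by simp
qed

text \<open>By \<open>ln u \<le> u - 1\<close>, \<open>s\<close> times the increase of the logarithm
  is at most \<open>t - s\<close>. The bound \<open>ln (s + 3) \<ge> 1\<close>, available down to 0
  through the shift by 3, absorbs this.\<close>

lemma div_ln_mono:
  fixes s t :: real
  assumes "0 \<le> s" "s \<le> t"
  shows "s / ln (s + 3) \<le> t / ln (t + 3)"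
proof -
  have s1: "ln (s + 3) \<ge> 1" and t1: "ln (t + 3) \<ge> 1"
    using assms ln_add_3_ge_1 by auto
  have "ln (t + 3) - ln (s + 3) = ln ((t + 3) / (s + 3))"
    using assms by (simp add: ln_div)
  also have "\<dots> \<le> (t + 3) / (s + 3) - 1"
    using assms by (intro ln_le_minus_one) auto
  also have "\<dots> = (t - s) / (s + 3)"
    using assms by (simp add: field_simps)
  finally have "s * (ln (t + 3) - ln (s + 3)) \<le> s * ((t - s) / (s + 3))"
    using assms by (intro mult_left_mono) auto
  also have "\<dots> = (s / (s + 3)) * (t - s)" by simp
  also have "\<dots> \<le> 1 * (t - s)"
    using assms by (intro mult_right_mono) auto
  also have "\<dots> \<le> ln (s + 3) * (t - s)"
    using s1 assms by (intro mult_right_mono) auto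
  finally have "s * ln (t + 3) \<le> t * ln (s + 3)"
    by (simp add: algebra_simps)
  thus ?thesis using s1 t1 by (simp add: field_simps)
qed

lemma weight_pos: "weight n > 0"
  by (simp add: weight_def)

lemma weight_mono: "weight m \<le> weight n" if "\<bar>m\<bar> \<le> \<bar>n\<bar>"
  using div_ln_mono[of "real_of_int \<bar>m\<bar>" "real_of_int \<bar>n\<bar>"] that by (simp add: weight_def)

text \<open>A shift of frequency costs a factor independent of \<open>n\<close>, so convolution with
  a fixed trigonometric polynomial preserves bounds by \<open>weight\<close> up to a constant. The
  denominator of the exponent is at least 1 and does not decrease when \<open>|n|\<close> grows to
  \<open>|n| + |k|\<close>.\<close>

lemma weight_diff_le: "weight (n - k) \<le> exp (real_of_int \<bar>k\<bar>) * weight n"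
proof -
  define t s where "t = real_of_int \<bar>n\<bar>" and "s = real_of_int \<bar>k\<bar>"
  have ts: "t \<ge> 0" "s \<ge> 0" by (auto simp: t_def s_def)
  have l1: "ln (t + 3) \<ge> 1" using ts ln_add_3_ge_1 by blast
  moreover have "ln (t + s + 3) \<ge> ln (t + 3)" using ts by simp
  ultimately have l: "ln (t + 3) \<ge> 1" "ln (t + s + 3) \<ge> 1" "ln (t + s + 3) \<ge> ln (t + 3)"
    by linarith+
  have "real_of_int \<bar>n - k\<bar> / ln (real_of_int \<bar>n - k\<bar> + 3) \<le> (t + s) / ln (t + s + 3)"
    by (intro div_ln_mono) (auto simp: t_def s_def)
  also have "\<dots> = t / ln (t + s + 3) + s / ln (t + s + 3)"
    by (simp add: add_divide_distrib)
  also have "\<dots> \<le> t / ln (t + 3) + s / 1"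
  proof (intro add_mono divide_left_mono)
    show "0 < ln (t + s + 3) * ln (t + 3)" "0 < ln (t + s + 3) * 1"
      using l by (auto intro!: mult_pos_pos simp del: ln_gt_zero_iff)
  qed (use ts l in \<open>simp_all only:\<close>)
  finally show ?thesis
    by (simp add: weight_def exp_add[symmetric] t_def s_def add_ac)
qed

lemma weight_at_top: "filterlim (\<lambda>n::nat. weight (int n)) at_top sequentially"
proof -
  have "filterlim (\<lambda>n::nat. exp (real n / ln (real n + 3))) at_top sequentially"
    by real_asymp
  thus ?thesis by (simp add: weight_def)
qed

section \<open>Truncated binomial expansions\<close>

definition trunc_binom :: "nat \<Rightarrow> nat \<Rightarrow> complex poly" where
  "trunc_binom M k = (\<Sum>i<k. smult (of_nat (M choose i)) ([:-1, 1:] ^ i))"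

lemma poly_trunc_binom:
  "poly (trunc_binom M k) X = (\<Sum>i<k. of_nat (M choose i) * (X - 1) ^ i)"
  by (simp add: trunc_binom_def poly_sum)

text \<open>For \<open>X = cis (2 * pi * n / L)\<close>, the power \<open>X ^ l\<close> is the n-th
  Fourier coefficient of a point mass at angle \<open>2 * pi * l / L\<close>, up to sign. Low degree
  therefore means point masses near 0.\<close>

lemma degree_trunc_binom: "degree (trunc_binom M k) \<le> k"
  unfolding trunc_binom_def
proof (rule degree_sum_le)
  fix i assume "i \<in> {..<k}"
  moreover have "degree (smult (of_nat (M choose i)) ([:-1, 1::complex:] ^ i)) \<le> degree ([:-1, 1::complex:] ^ i)"
    by (rule degree_smult_le)
  moreover have "degree ([:-1, 1::complex:] ^ i) \<le> i"
    using degree_power_le[of "[:-1, 1::complex:]" i] by simp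
  ultimately show "degree (smult (of_nat (M choose i)) ([:-1, 1::complex:] ^ i)) \<le> k"
    by simp
qed auto

text \<open>Pascal's rule, from multiplication by \<open>X = 1 + (X - 1)\<close>. The factor
  \<open>X - 1\<close> raises the order, hence the shorter truncation in the second term.\<close>

lemma trunc_binom_Suc:
  "poly (trunc_binom (Suc M) (Suc k)) X =
     poly (trunc_binom M (Suc k)) X + (X - 1) * poly (trunc_binom M k) X"
proof -
  have "poly (trunc_binom (Suc M) (Suc k)) X =
      1 + (\<Sum>i<k. of_nat (Suc M choose Suc i) * (X - 1) ^ Suc i)"
    unfolding poly_trunc_binom by (subst sum.lessThan_Suc_shift) simp
  also have "\<dots> = (1 + (\<Sum>i<k. of_nat (M choose Suc i) * (X - 1) ^ Suc i)) +
      (X - 1) * (\<Sum>i<k. of_nat (M choose i) * (X - 1) ^ i)"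
    by (simp add: distrib_right distrib_left sum.distrib sum_distrib_left mult_ac add_ac)
  also have "1 + (\<Sum>i<k. of_nat (M choose Suc i) * (X - 1) ^ Suc i) = poly (trunc_binom M (Suc k)) X"
    unfolding poly_trunc_binom by (subst sum.lessThan_Suc_shift) simp
  finally show ?thesis by (simp add: poly_trunc_binom)
qed

text \<open>The remainders obey the recursion of \<open>trunc_binom_Suc\<close>, and the bounds add
  up by Pascal's rule. That \<open>X\<close> is unimodular enters for \<open>k = 0\<close>, where
  the remainder is \<open>X ^ M\<close>.\<close>

lemma trunc_binom_remainder:
  assumes "norm X = 1"
  shows "norm (X ^ M - poly (trunc_binom M k) X) \<le> real (M choose k) * norm (X - 1) ^ k"
proof (induction M arbitrary: k)
  case 0
  show ?case
  proof (cases k)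
    case (Suc k')
    have "poly (trunc_binom 0 (Suc k')) X = 1"
      unfolding poly_trunc_binom by (subst sum.lessThan_Suc_shift) simp
    thus ?thesis using Suc by simp
  qed (simp add: poly_trunc_binom)
next
  case (Suc M)
  show ?case
  proof (cases k)
    case 0
    thus ?thesis using assms by (simp add: poly_trunc_binom norm_mult norm_power)
  next
    case k: (Suc k')
    have "X ^ Suc M - poly (trunc_binom (Suc M) k) X =
        (X ^ M - poly (trunc_binom M k) X) + (X - 1) * (X ^ M - poly (trunc_binom M k') X)"
      unfolding k trunc_binom_Suc by (simp add: algebra_simps)
    also have "norm \<dots> \<le> norm (X ^ M - poly (trunc_binom M k) X) +
        norm (X - 1) * norm (X ^ M - poly (trunc_binom M k') X)"
      by (metis norm_mult norm_triangle_ineq)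
    also have "\<dots> \<le> real (M choose k) * norm (X - 1) ^ k +
        norm (X - 1) * (real (M choose k') * norm (X - 1) ^ k')"
      by (intro add_mono mult_left_mono Suc.IH) auto
    also have "\<dots> = real (Suc M choose k) * norm (X - 1) ^ k"
      unfolding k by (simp add: algebra_simps)
    finally show ?thesis .
  qed
qed

lemma choose_mult_power_le:
  assumes "real M * y \<le> x" "y \<ge> 0"
  shows "real (M choose k) * y ^ k \<le> x ^ k / fact k"
proof -
  have "real ((M choose k) * fact k) \<le> real (M ^ k)"
    using binomial_fact_pow by (subst of_nat_le_iff) 
  hence "real (M choose k) * fact k * y ^ k \<le> real M ^ k * y ^ k"
    using assms by (intro mult_right_mono) auto
  also have "\<dots> = (real M * y) ^ k" by (simp add: power_mult_distrib)
  also have "\<dots> \<le> x ^ k" using assms by (intro power_mono) auto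
  finally show ?thesis by (simp add: field_simps)
qed

lemma norm_trunc_binom_le:
  assumes "real M * norm (X - 1) \<le> x"
  shows "norm (poly (trunc_binom M k) X) \<le> (\<Sum>l<k. x ^ l / fact l)"
  unfolding poly_trunc_binom
proof (rule order_trans[OF norm_sum], rule sum_mono)
  fix i
  show "norm (of_nat (M choose i) * (X - 1) ^ i) \<le> x ^ i / fact i"
    using choose_mult_power_le[OF assms] by (simp add: norm_mult norm_power)
qed

section \<open>Partial exponential sums against the weight\<close>

lemma power_div_fact_le_exp:
  assumes "x \<ge> 0" shows "x ^ k / fact k \<le> exp (x::real)"
proof -
  have "(\<Sum>i\<in>{k}. x ^ i /\<^sub>R fact i) \<le> exp x"
    unfolding exp_def
    by (rule sum_le_suminf[OF summable_exp_generic]) (use assms in auto)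
  thus ?thesis by (simp add: field_simps)
qed

lemma exp_partial_sum_le:
  assumes "x \<ge> 0" shows "(\<Sum>l<k. x ^ l / fact l) \<le> exp (x::real)"
proof -
  have "(\<Sum>l<k. x ^ l /\<^sub>R fact l) \<le> exp x"
    unfolding exp_def
    by (rule sum_le_suminf[OF summable_exp_generic]) (use assms in auto)
  thus ?thesis by (simp add: field_simps)
qed

text \<open>Stretching by \<open>\<Lambda>\<close> trades exponential growth for a power: each term
  gains at most \<open>\<Lambda> ^ k\<close>, and what remains is the series at
  \<open>x / \<Lambda>\<close>.\<close>

lemma exp_partial_sum_scaled:
  assumes "x \<ge> 0" "\<Lambda> \<ge> 1"
  shows "(\<Sum>l<k. x ^ l / fact l) \<le> \<Lambda> ^ k * exp (x / \<Lambda> :: real)"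
proof -
  have "(\<Sum>l<k. x ^ l / fact l) \<le> (\<Sum>l<k. \<Lambda> ^ k * ((x / \<Lambda>) ^ l / fact l))"
  proof (rule sum_mono)
    fix l assume "l \<in> {..<k}"
    hence "\<Lambda> ^ l \<le> \<Lambda> ^ k" using assms by (intro power_increasing) auto
    hence "\<Lambda> ^ l * ((x / \<Lambda>) ^ l / fact l) \<le> \<Lambda> ^ k * ((x / \<Lambda>) ^ l / fact l)"
      using assms by (intro mult_right_mono) auto
    thus "x ^ l / fact l \<le> \<Lambda> ^ k * ((x / \<Lambda>) ^ l / fact l)"
      using assms by (simp add: power_divide)
  qed
  also have "\<dots> = \<Lambda> ^ k * (\<Sum>l<k. (x / \<Lambda>) ^ l / fact l)"
    by (simp add: sum_distrib_left)
  also have "\<dots> \<le> \<Lambda> ^ k * exp (x / \<Lambda>)"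
    using assms by (intro mult_left_mono exp_partial_sum_le) auto
  finally show ?thesis .
qed

text \<open>The bound for \<open>\<Lambda>\<close> at level \<open>j + 1\<close> comes from the bound for \<open>2 * \<Lambda>\<close> at level \<open>j\<close>, so \<open>\<Lambda>\<close> has to
  vary in the induction.\<close>
lemma prod_exp_partial_sum_le:
  fixes x \<Lambda> :: real
  assumes "2 \<le> a" "a \<le> j" "x \<ge> 0" "\<Lambda> \<ge> 1"
  shows "(\<Prod>i\<in>{a..<j}. \<Sum>l<2^i. (x / real i) ^ l / fact l) \<le> (4 * \<Lambda>) ^ (2^j) * exp (3 * x / (\<Lambda> * real j))"
  using assms(2,4)
proof (induction j arbitrary: \<Lambda> rule: dec_induct)
  case base
  have "1 * 1 \<le> (4 * \<Lambda>) ^ (2^a) * exp (3 * x / (\<Lambda> * real a))"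
    using base assms by (intro mult_mono one_le_power) auto
  thus ?case by simp
next
  case (step j)
  have j: "j \<ge> 2" using step assms by simp
  \<comment> \<open>The constant 4 is the one that reproduces itself here: \<open>(c * 2 *
    \<Lambda>) * (2 * \<Lambda>) = (c * \<Lambda>)\<^sup>2\<close> for \<open>c = 4\<close>.\<close>
  have mul: "(4 * (2 * \<Lambda>)) ^ k * (2 * \<Lambda>) ^ k = (4 * \<Lambda>) ^ (2 * k)" for k :: nat
  proof -
    have "(4 * (2 * \<Lambda>)) ^ k * (2 * \<Lambda>) ^ k = ((4 * (2 * \<Lambda>)) * (2 * \<Lambda>)) ^ k"
      by (simp only: power_mult_distrib)
    also have "(4 * (2 * \<Lambda>)) * (2 * \<Lambda>) = (4 * \<Lambda>) ^ 2"
      by (simp add: power2_eq_square)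
    finally show ?thesis by (simp only: power_mult)
  qed
  have "(\<Prod>i\<in>{a..<Suc j}. \<Sum>l<2^i. (x / real i) ^ l / fact l) =
      (\<Prod>i\<in>{a..<j}. \<Sum>l<2^i. (x / real i) ^ l / fact l) * (\<Sum>l<2^j. (x / real j) ^ l / fact l)"
    using step by (subst prod.atLeastLessThan_Suc) auto
  also have "\<dots> \<le> ((4 * (2 * \<Lambda>)) ^ (2^j) * exp (3 * x / (2 * \<Lambda> * real j))) *
      ((2 * \<Lambda>) ^ (2^j) * exp (x / real j / (2 * \<Lambda>)))"
    using step.prems assms
    by (intro mult_mono step.IH exp_partial_sum_scaled sum_nonneg mult_nonneg_nonneg) auto
  also have "\<dots> = ((4 * (2 * \<Lambda>)) ^ (2^j) * (2 * \<Lambda>) ^ (2^j)) *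
      (exp (3 * x / (2 * \<Lambda> * real j)) * exp (x / real j / (2 * \<Lambda>)))"
    by (simp only: mult_ac)
  also have "(4 * (2 * \<Lambda>)) ^ (2^j) * (2 * \<Lambda>) ^ (2^j) = (4 * \<Lambda>) ^ (2 ^ Suc j)"
    by (simp only: mul power_Suc)
  \<comment> \<open>The coefficients 3/2 and 1/2 add up to 2, and
    \<open>2 / j \<le> 3 / (j + 1)\<close> for \<open>j \<ge> 2\<close> restores the constant
    3.\<close>
  also have "exp (3 * x / (2 * \<Lambda> * real j)) * exp (x / real j / (2 * \<Lambda>)) = exp (x / \<Lambda> * (2 / real j))"
    using step.prems j by (simp add: exp_add[symmetric] field_simps)
  also have "(4 * \<Lambda>) ^ (2 ^ Suc j) * exp (x / \<Lambda> * (2 / real j)) \<le>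
      (4 * \<Lambda>) ^ (2 ^ Suc j) * exp (x / \<Lambda> * (3 / real (Suc j)))"
  proof -
    have "2 / real j \<le> 3 / real (Suc j)" using j by (simp add: field_simps)
    hence "x / \<Lambda> * (2 / real j) \<le> x / \<Lambda> * (3 / real (Suc j))"
      using assms(3) step.prems by (intro mult_left_mono) auto
    thus ?thesis using step.prems by simp
  qed
  also have "x / \<Lambda> * (3 / real (Suc j)) = 3 * x / (\<Lambda> * real (Suc j))" by simp
  finally show ?case .
qed

text \<open>This is a summand of the telescoped error: bounds for the earlier truncated factors
  times the remainder of stage \<open>j\<close>. Writing \<open>x / j\<close> as
  \<open>\<Lambda> / 16\<close> times \<open>16 * x / (\<Lambda> * j)\<close> turns the base
  \<open>4 * \<Lambda>\<close> into \<open>\<Lambda>\<^sup>2 / 4\<close>, which is below 1 for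
  \<open>\<Lambda> = 1\<close>. The price is the coefficient 3 + 16 = 19 in the exponent.\<close>

lemma stage_term_scaled:
  fixes x \<Lambda> :: real
  assumes "2 \<le> a" "a \<le> j" "x \<ge> 0" "\<Lambda> \<ge> 1"
  shows "(\<Prod>i\<in>{a..<j}. \<Sum>l<2^i. (x / real i) ^ l / fact l) * ((x / real j) ^ (2^j) / fact (2^j))
    \<le> (\<Lambda>\<^sup>2 / 4) ^ (2^j) * exp (19 * x / (\<Lambda> * real j))"
proof -
  have A: "(x / real j) ^ k = (\<Lambda> / 16) ^ k * (16 * x / (\<Lambda> * real j)) ^ k"
    "(4 * \<Lambda>) ^ k * (\<Lambda> / 16) ^ k = (\<Lambda>\<^sup>2 / 4) ^ k" for k :: nat
    unfolding power_mult_distrib[symmetric] using assms by (auto simp: power2_eq_square)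
  have B: "exp (3 * x / (\<Lambda> * real j)) * exp (16 * x / (\<Lambda> * real j)) = exp (19 * x / (\<Lambda> * real j))"
    by (simp add: exp_add[symmetric] add_divide_distrib[symmetric])
  have "(x / real j) ^ (2^j) / fact (2^j) = (\<Lambda> / 16) ^ (2^j) * ((16 * x / (\<Lambda> * real j)) ^ (2^j) / fact (2^j))"
    by (simp only: A(1) times_divide_eq_right)
  also have "\<dots> \<le> (\<Lambda> / 16) ^ (2^j) * exp (16 * x / (\<Lambda> * real j))"
    using assms by (intro mult_left_mono power_div_fact_le_exp) auto
  finally have "(\<Prod>i\<in>{a..<j}. \<Sum>l<2^i. (x / real i) ^ l / fact l) * ((x / real j) ^ (2^j) / fact (2^j))
     \<le> ((4 * \<Lambda>) ^ (2^j) * exp (3 * x / (\<Lambda> * real j))) * ((\<Lambda> / 16) ^ (2^j) * exp (16 * x / (\<Lambda> * real j)))"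
    using assms by (intro mult_mono prod_exp_partial_sum_le) auto
  also have "\<dots> = ((4 * \<Lambda>) ^ (2^j) * (\<Lambda> / 16) ^ (2^j)) * (exp (3 * x / (\<Lambda> * real j)) * exp (16 * x / (\<Lambda> * real j)))"
    by (simp only: mult_ac)
  also have "\<dots> = (\<Lambda>\<^sup>2 / 4) ^ (2^j) * exp (19 * x / (\<Lambda> * real j))"
    by (simp only: A B)
  finally show ?thesis .
qed

text \<open>The free parameter of \<open>stage_term_scaled\<close> is 1 as long as the weight dominates
  \<open>exp (\<bar>n\<bar> / (8 * j))\<close>; beyond that it grows like \<open>ln \<bar>n\<bar>\<close> and balances the power of \<open>\<Lambda>\<close> against the
  exponential.\<close>
lemma stage_term_le_weight:
  fixes n :: int
  assumes "2 \<le> a" "a \<le> j" and x: "x = real_of_int \<bar>n\<bar> / 152"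
  shows "(\<Prod>i\<in>{a..<j}. \<Sum>l<2^i. (x / real i) ^ l / fact l) * ((x / real j) ^ (2^j) / fact (2^j))
    \<le> (1 / 2) ^ (2^j) * weight n"
proof -
  define t l where "t = real_of_int \<bar>n\<bar>" and "l = ln (t + 3)"
  have t: "t \<ge> 0" by (simp add: t_def)
  \<comment> \<open>The divisor 152 is 8 * 19.\<close>
  have x0: "x \<ge> 0" and xt: "19 * x = t / 8" using x by (auto simp: t_def)
  have l1: "l \<ge> 1" using ln_add_3_ge_1[OF t] by (simp add: l_def)
  have j: "real j \<ge> 2" using assms by simp
  have w: "weight n = exp (t / l)" by (simp add: weight_def t_def l_def)
  show ?thesis
  proof (cases "l \<le> 8 * real j")
    case True
    have "(1 / 4 :: real) ^ (2^j) \<le> (1 / 2) ^ (2^j)" by (intro power_mono) auto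
    moreover have "exp (t / 8 / real j) \<le> exp (t / l)"
      using True t l1 by (auto intro!: divide_left_mono)
    ultimately have "(1 / 4) ^ (2^j) * exp (19 * x / (1 * real j)) \<le> (1 / 2) ^ (2^j) * weight n"
      unfolding w xt by (intro mult_mono) auto
    thus ?thesis using stage_term_scaled[OF assms(1,2) x0, of 1] by simp
  next
    case False
    \<comment> \<open>With \<open>\<Lambda> * j = l / 4\<close> the exponential uses exactly half of
      the exponent \<open>t / l\<close> of the weight. The other half has to dominate
      \<open>\<Lambda> ^ (2 * 2 ^ j)\<close>.\<close>
    define \<Lambda> where "\<Lambda> = l / (4 * real j)"
    have L: "\<Lambda> \<ge> 1" "\<Lambda> \<le> l / 8"
    proof -
      show "\<Lambda> \<ge> 1" using False j unfolding \<Lambda>_def by (simp add: field_simps)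
      show "\<Lambda> \<le> l / 8" using j l1 unfolding \<Lambda>_def by (intro divide_left_mono) auto
    qed
    have l16: "l > 16" using False j by linarith
    have e: "19 * x / (\<Lambda> * real j) = t / (2 * l)"
      unfolding xt \<Lambda>_def using j l1 by (simp add: field_simps)
    have "real (2 ^ j) = exp (real j * ln 2)"
      by (simp add: exp_of_nat_mult)
    also have "\<dots> \<le> exp (l / 8)"
    proof -
      have "real j * ln 2 \<le> real j * 1" using ln_2_less_1 by (intro mult_left_mono) auto
      thus ?thesis using False by simp
    qed
    finally have k: "real (2 ^ j) \<le> exp (l / 8)" .
    have "ln \<Lambda> \<le> l / 8" using L ln_le_minus_one[of \<Lambda>] by simp
    hence "ln \<Lambda> * (2 * real (2 ^ j)) \<le> l / 8 * (2 * exp (l / 8))"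
      using k l1 L by (intro mult_mono) auto
    \<comment> \<open>Since \<open>t + 3 = exp l\<close>, everything on the left is a small power of
      \<open>t + 3\<close>: it suffices that \<open>32 * exp (3 * l / 8) \<le> exp l - 3\<close>,
      which \<open>l > 16\<close> ensures.\<close>
    also have "\<dots> \<le> t / (2 * l)"
    proof -
      have "l / 8 \<le> exp (l / 8)" using exp_ge_add_one_self[of "l / 8"] by linarith
      hence "(l / 8) * (l / 8) * exp (l / 8) \<le> exp (l / 8) * exp (l / 8) * exp (l / 8)"
        using l1 by (intro mult_mono) auto
      also have "\<dots> = exp (3 * (l / 8))" by (simp add: exp_add[symmetric])
      finally have "l * l * exp (l / 8) / 2 \<le> 32 * exp (3 * (l / 8))" by simp
      also have "\<dots> \<le> exp l - 3"
      proof -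
        have a: "exp (3 * (l / 8)) \<ge> 1" using l1 by simp
        have "2 ^ 10 \<le> exp (1::real) ^ 10" using exp_ge_add_one_self[of "1::real"] by (intro power_mono) auto
        also have "\<dots> = exp 10" by (simp add: exp_of_nat_mult[symmetric])
        also have "\<dots> \<le> exp (5 * (l / 8))" using l16 by simp
        finally have b: "35 \<le> exp (5 * (l / 8))" by simp
        have "exp (3 * (l / 8)) * 35 \<le> exp (3 * (l / 8)) * exp (5 * (l / 8))"
          using b by (intro mult_left_mono) auto
        also have "\<dots> = exp l" by (simp add: exp_add[symmetric])
        finally show ?thesis using a by linarith
      qed
      also have "\<dots> = t" using t by (simp add: l_def)
      finally show ?thesis using l1 by (simp add: field_simps)
    qed
    finally have "exp (ln \<Lambda> * (2 * real (2 ^ j))) \<le> exp (t / (2 * l))" by simp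
    moreover have "exp (ln \<Lambda> * (2 * real (2 ^ j))) = (\<Lambda>\<^sup>2) ^ (2 ^ j)"
    proof -
      have "exp (ln \<Lambda> * (2 * real (2 ^ j))) = exp (real (2 * 2 ^ j) * ln \<Lambda>)" by (simp add: mult_ac)
      also have "\<dots> = \<Lambda> ^ (2 * 2 ^ j)" using L by (subst exp_of_nat_mult) simp
      finally show ?thesis by (simp add: power_mult)
    qed
    ultimately have A: "(\<Lambda>\<^sup>2) ^ (2 ^ j) \<le> exp (t / (2 * l))" by metis
    have "(\<Lambda>\<^sup>2 / 4) ^ (2^j) * exp (t / (2 * l)) = (1/4) ^ (2^j) * (\<Lambda>\<^sup>2) ^ (2 ^ j) * exp (t / (2 * l))"
      by (simp add: power_divide)
    also have "\<dots> \<le> (1/2) ^ (2^j) * exp (t / (2 * l)) * exp (t / (2 * l))"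
      using A by (intro mult_mono power_mono) auto
    also have "\<dots> = (1/2) ^ (2^j) * weight n"
      unfolding w by (simp add: exp_add[symmetric] field_simps)
    finally show ?thesis
      using stage_term_scaled[OF assms(1,2) x0 L(1)] unfolding e by linarith
  qed
qed

text \<open>The factors are exchanged one at a time; those not yet exchanged have norm 1 and
  disappear from the bound.\<close>

lemma norm_prod_diff_le:
  fixes y \<tau> :: "nat \<Rightarrow> complex"
  assumes "a \<le> b" "\<And>i. i \<in> {a..<b} \<Longrightarrow> norm (y i) = 1"
  shows "norm ((\<Prod>i\<in>{a..<b}. y i) - (\<Prod>i\<in>{a..<b}. \<tau> i))
    \<le> (\<Sum>j\<in>{a..<b}. (\<Prod>i\<in>{a..<j}. norm (\<tau> i)) * norm (y j - \<tau> j))"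
  using assms
proof (induction b rule: dec_induct)
  case base
  show ?case by simp
next
  case (step b)
  let ?Y = "\<Prod>i\<in>{a..<b}. y i" and ?T = "\<Prod>i\<in>{a..<b}. \<tau> i"
  have "(\<Prod>i\<in>{a..<Suc b}. y i) - (\<Prod>i\<in>{a..<Suc b}. \<tau> i) = (?Y - ?T) * y b + ?T * (y b - \<tau> b)"
    using step by (simp add: algebra_simps)
  also have "norm \<dots> \<le> norm (?Y - ?T) * norm (y b) + norm ?T * norm (y b - \<tau> b)"
    by (metis norm_mult norm_triangle_ineq)
  also have "norm (y b) = 1" using step by auto
  also have "norm ?T = (\<Prod>i\<in>{a..<b}. norm (\<tau> i))" by (simp add: prod_norm)
  finally show ?case using step by fastforce
qed

text \<open>Greedy choice: the last stage takes as much of \<open>M\<close> as its cap allows, and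
  induction splits the rest.\<close>

lemma sum_split_bounded:
  fixes B :: "nat \<Rightarrow> nat"
  assumes "M \<le> (\<Sum>j\<in>{a..<b}. B j)"
  shows "\<exists>m. (\<forall>j. m j \<le> B j) \<and> (\<Sum>j\<in>{a..<b}. m j) = M"
proof (cases "a \<le> b")
  case False
  thus ?thesis using assms by (intro exI[of _ "\<lambda>_. 0"]) auto
next
  case True
  thus ?thesis using assms
  proof (induction b arbitrary: M rule: dec_induct)
    case base
    thus ?case by (intro exI[of _ "\<lambda>_. 0"]) auto
  next
    case (step b)
    have "M - min M (B b) \<le> (\<Sum>j\<in>{a..<b}. B j)" using step by auto
    then obtain m where m: "\<forall>j. m j \<le> B j" "(\<Sum>j\<in>{a..<b}. m j) = M - min M (B b)"
      using step.IH by blast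
    have "(\<Sum>j\<in>{a..<b}. (m(b := min M (B b))) j) = (\<Sum>j\<in>{a..<b}. m j)"
      by (intro sum.cong) auto
    thus ?case using m step(1)
      by (intro exI[of _ "m(b := min M (B b))"]) auto
  qed
qed

text \<open>The exponent is spread over the stages so that stage \<open>j\<close> has argument at
  most \<open>x / j\<close> with \<open>x = |n| / 152\<close>. The telescoped errors are then those
  of \<open>stage_term_le_weight\<close>, and their factors are dominated by a geometric
  series.\<close>

lemma prod_trunc_binom_approx:
  fixes n :: int and m :: "nat \<Rightarrow> nat"
  assumes "2 \<le> a" "a \<le> b" "norm X = 1"
    and m: "\<And>j. j \<in> {a..<b} \<Longrightarrow> real (m j) * norm (X - 1) \<le> real_of_int \<bar>n\<bar> / 152 / real j"
  shows "norm (X ^ (\<Sum>j\<in>{a..<b}. m j) - (\<Prod>j\<in>{a..<b}. poly (trunc_binom (m j) (2^j)) X))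
    \<le> 2 * (1 / 2) ^ a * weight n"
proof -
  define x where "x = real_of_int \<bar>n\<bar> / 152"
  have x0: "x \<ge> 0" by (simp add: x_def)
  have "norm ((\<Prod>j\<in>{a..<b}. X ^ m j) - (\<Prod>j\<in>{a..<b}. poly (trunc_binom (m j) (2^j)) X))
    \<le> (\<Sum>j\<in>{a..<b}. (\<Prod>i\<in>{a..<j}. norm (poly (trunc_binom (m i) (2^i)) X)) *
        norm (X ^ m j - poly (trunc_binom (m j) (2^j)) X))"
    using assms by (intro norm_prod_diff_le) (auto simp: norm_power)
  also have "\<dots> \<le> (\<Sum>j\<in>{a..<b}. (1 / 2) ^ (2^j) * weight n)"
  proof (rule sum_mono)
    fix j assume j: "j \<in> {a..<b}"
    have "norm (X ^ m j - poly (trunc_binom (m j) (2^j)) X) \<le> real (m j choose 2^j) * norm (X - 1) ^ (2^j)"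
      by (rule trunc_binom_remainder[OF assms(3)])
    also have "\<dots> \<le> (x / real j) ^ (2^j) / fact (2^j)"
      using m[OF j] by (intro choose_mult_power_le) (auto simp: x_def)
    finally have 1: "norm (X ^ m j - poly (trunc_binom (m j) (2^j)) X) \<le> (x / real j) ^ (2^j) / fact (2^j)" .
    have 2: "norm (poly (trunc_binom (m i) (2^i)) X) \<le> (\<Sum>l<2^i. (x / real i) ^ l / fact l)"
      if "i \<in> {a..<j}" for i
      using m[of i] that j by (intro norm_trunc_binom_le) (auto simp: x_def)
    have "(\<Prod>i\<in>{a..<j}. norm (poly (trunc_binom (m i) (2^i)) X)) *
        norm (X ^ m j - poly (trunc_binom (m j) (2^j)) X)
      \<le> (\<Prod>i\<in>{a..<j}. \<Sum>l<2^i. (x / real i) ^ l / fact l) * ((x / real j) ^ (2^j) / fact (2^j))"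
      using 2 x0 by (intro mult_mono 1 prod_mono prod_nonneg sum_nonneg conjI) auto
    also have "\<dots> \<le> (1 / 2) ^ (2^j) * weight n"
      using assms j by (intro stage_term_le_weight) (auto simp: x_def)
    finally show "(\<Prod>i\<in>{a..<j}. norm (poly (trunc_binom (m i) (2^i)) X)) *
        norm (X ^ m j - poly (trunc_binom (m j) (2^j)) X) \<le> (1 / 2) ^ (2^j) * weight n" .
  qed
  also have "\<dots> = (\<Sum>j\<in>{a..<b}. (1 / 2) ^ (2^j)) * weight n"
    by (simp add: sum_distrib_right)
  also have "\<dots> \<le> (2 * (1 / 2) ^ a) * weight n"
  proof (rule mult_right_mono)
    have "(\<Sum>j\<in>{a..<b}. (1 / 2) ^ (2^j)) \<le> (\<Sum>j\<in>{a..<b}. (1 / 2 :: real) ^ j)"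
      by (intro sum_mono power_decreasing) (auto intro: less_imp_le less_exp)
    also have "\<dots> = 2 * (1/2) ^ a - 2 * (1 / 2) ^ b"
      using assms(2) by (induction b rule: dec_induct) auto
    finally show "(\<Sum>j\<in>{a..<b}. (1 / 2) ^ (2^j)) \<le> 2 * (1 / 2 :: real) ^ a"
      by (smt (verit) zero_le_power zero_le_divide_1_iff)
  qed (use weight_pos less_imp_le in blast)
  finally show ?thesis by (simp add: power_sum)
qed

section \<open>Averaging over all rotations\<close>

lemma norm_cis_minus_1_le: "norm (cis x - 1) \<le> \<bar>x\<bar>"
proof -
  have "(norm (cis x - 1))\<^sup>2 = (cos x - 1)\<^sup>2 + (sin x)\<^sup>2"
    by (simp add: cmod_power2)
  also have "\<dots> = 2 - 2 * cos (2 * (x / 2))"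
    using sin_cos_squared_add[of x] by (simp add: power2_diff)
  also have "\<dots> = (2 * sin (x / 2))\<^sup>2"
    by (subst cos_double_sin) (simp add: power_mult_distrib)
  also have "\<dots> = (2 * \<bar>sin (x / 2)\<bar>)\<^sup>2" by (simp add: power_mult_distrib)
  also have "\<dots> \<le> \<bar>x\<bar>\<^sup>2"
    using abs_sin_x_le_abs_x[of "x / 2"] by (intro power_mono) auto
  finally show ?thesis by (simp only: abs_ge_zero power2_le_imp_le)
qed

lemma sum_inverse_ge_ln:
  assumes "1 \<le> a" "a \<le> b"
  shows "(\<Sum>j\<in>{a..<b}. 1 / real j) \<ge> ln (real b) - ln (real a)"
  using assms(2)
proof (induction b rule: dec_induct)
  case (step j)
  have j: "j \<ge> 1" using step assms by simp
  have "ln (real (Suc j)) - ln (real j) = ln (real (Suc j) / real j)"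
    using j by (simp add: ln_div)
  also have "\<dots> \<le> real (Suc j) / real j - 1"
    using j by (intro ln_le_minus_one) auto
  also have "\<dots> = 1 / real j" using j by (simp add: field_simps)
  finally show ?case using step by simp
qed auto

lemma cis_root_eq_1_dvd:
  assumes "cis (2 * pi * real_of_int n / real L) = 1" "L > 0"
  shows "int L dvd n"
proof -
  obtain k where "2 * pi * real_of_int n / real L = of_int k * (2 * pi)"
    using assms(1) by (auto simp: cis_conv_exp exp_eq_1)
  hence "real_of_int n = of_int k * of_int (int L)" using assms(2) by (simp add: field_simps)
  hence "n = k * int L" by (metis of_int_eq_iff of_int_mult)
  thus ?thesis by simp
qed

text \<open>The mean of \<open>X ^ M\<close> over \<open>M < L\<close> is 1 if \<open>L\<close>
  divides \<open>n\<close> and 0 otherwise; nonzero multiples of \<open>L\<close> are harmless once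
  \<open>weight L\<close> is large. Each \<open>X ^ M\<close> is replaced by a product of truncated
  binomials whose degree is bounded in terms of \<open>b\<close> alone. As \<open>L\<close> is
  chosen after \<open>b\<close>, all powers up to that degree stay near 1.\<close>

lemma approx_delta_poly:
  fixes \<epsilon> \<delta> :: real
  assumes "\<epsilon> > 0" "\<delta> > 0"
  obtains L :: nat and q :: "complex poly" where
    "L > 0"
    "\<And>l. l \<le> degree q \<Longrightarrow> norm (cis (2 * pi / real L) ^ l - 1) \<le> \<delta>"
    "\<And>n::int. norm (poly q (cis (2 * pi * real_of_int n / real L)) - of_bool (n = 0)) \<le> \<epsilon> * weight n"
proof -
  obtain a0 :: nat where a0: "(1/2) ^ a0 < \<epsilon> / 4"
    using real_arch_pow_inv[of "\<epsilon> / 4" "1/2"] assms by auto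
  define a where "a = a0 + 2"
  have "2 * (1 / 2) ^ a = (1 / 2 :: real) ^ a0 / 2" "(0::real) \<le> (1 / 2) ^ a0"
    by (simp_all add: a_def)
  hence a: "a \<ge> 2" "2 * (1 / 2) ^ a \<le> \<epsilon> / 2"
    using a0 by (simp add: a_def, linarith)
  \<comment> \<open>At most \<open>2 * L / (C * j)\<close> rotation steps in stage \<open>j\<close>,
    each contributing at most \<open>2 * pi * |n| / L\<close>, give exactly the admissible total
    \<open>|n| / (152 * j)\<close>.\<close>
  define C where "C = 4 * pi * 152"
  have C: "C > 0" by (simp add: C_def)
  have "\<exists>b\<ge>a. (\<Sum>j\<in>{a..<b}. 1 / real j) \<ge> C"
  proof (intro exI conjI)
    define b where "b = a + nat \<lceil>real a * exp C\<rceil>"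
    have "real a * exp C \<le> real b" unfolding b_def by linarith
    hence "ln (real a * exp C) \<le> ln (real b)"
      using a by (intro ln_mono) auto
    also have "ln (real a * exp C) = ln (real a) + C" using a by (simp add: ln_mult)
    finally show "(\<Sum>j\<in>{a..<b}. 1 / real j) \<ge> C"
      using sum_inverse_ge_ln[of a b] a by (simp add: b_def)
    show "a \<le> b" by (simp add: b_def)
  qed
  then obtain b where b: "a \<le> b" "(\<Sum>j\<in>{a..<b}. 1 / real j) \<ge> C" by blast
  have "eventually (\<lambda>L::nat. weight (int L) \<ge> 2 / \<epsilon>) sequentially"
    using weight_at_top unfolding filterlim_at_top by blast
  moreover have "eventually (\<lambda>L::nat. real L \<ge> 2 * pi * 2 ^ b / \<delta>) sequentially"
    by real_asymp
  moreover have "eventually (\<lambda>L::nat. real L \<ge> C * real b) sequentially"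
    by real_asymp
  moreover have "eventually (\<lambda>L::nat. L > 0) sequentially"
    by (rule eventually_gt_at_top)
  ultimately have "eventually (\<lambda>L::nat. weight (int L) \<ge> 2 / \<epsilon> \<and> real L \<ge> 2 * pi * 2 ^ b / \<delta> \<and>
      real L \<ge> C * real b \<and> L > 0) sequentially"
    by eventually_elim blast
  then obtain L :: nat where L: "weight (int L) \<ge> 2 / \<epsilon>" "real L \<ge> 2 * pi * 2 ^ b / \<delta>"
      "real L \<ge> C * real b" "L > 0"
    by (auto simp: eventually_at_top_linorder)
  \<comment> \<open>The factor 2 pays for rounding down: \<open>L \<ge> C * b\<close> gives
    \<open>L / (C * j) \<ge> 1\<close>, so each cap in the range is at least
    \<open>L / (C * j)\<close>. The harmonic sum is at least \<open>C\<close>, hence the caps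
    together reach \<open>L\<close>.\<close>
  define B where "B = (\<lambda>j::nat. nat \<lfloor>2 * real L / (C * real j)\<rfloor>)"
  have B_le: "real (B j) \<le> 2 * real L / (C * real j)" for j
    unfolding B_def using C L(4) by (simp add: of_nat_nat)
  have B_ge: "real (B j) \<ge> real L / (C * real j)" if "j \<in> {a..<b}" for j
  proof -
    have "1 \<le> real L / (C * real j)"
    proof -
      have "C * real j \<le> C * real b" using that C by (intro mult_left_mono) auto
      hence "C * real j \<le> real L" using L(3) by linarith
      thus ?thesis using that a C by simp
    qed
    moreover have "real (B j) \<ge> 2 * real L / (C * real j) - 1" unfolding B_def by linarith
    moreover have "2 * real L / (C * real j) = real L / (C * real j) + real L / (C * real j)"
      by (simp flip: add_divide_distrib)
    ultimately show ?thesis by linarith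
  qed
  have "real L \<le> real L / C * (\<Sum>j\<in>{a..<b}. 1 / real j)"
    using b(2) C L(4) by (simp add: field_simps)
  also have "\<dots> = (\<Sum>j\<in>{a..<b}. real L / (C * real j))"
    by (simp add: sum_distrib_left)
  also have "\<dots> \<le> (\<Sum>j\<in>{a..<b}. real (B j))" by (intro sum_mono B_ge)
  finally have L_le: "L \<le> (\<Sum>j\<in>{a..<b}. B j)" by (simp flip: of_nat_sum)
  have "\<exists>m. (\<forall>j. m j \<le> B j) \<and> (\<Sum>j\<in>{a..<b}. m j) = M" if "M < L" for M
    using sum_split_bounded[of M B a b] L_le that by simp
  then obtain m where m: "\<And>M j. M < L \<Longrightarrow> m M j \<le> B j"
      "\<And>M. M < L \<Longrightarrow> (\<Sum>j\<in>{a..<b}. m M j) = M"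
    by metis
  define T where "T = (\<lambda>M. \<Prod>j\<in>{a..<b}. trunc_binom (m M j) (2^j))"
  define q where "q = smult (1 / of_nat L) (\<Sum>M<L. T M)"
  have "degree (T M) \<le> 2 ^ b" for M
  proof -
    have "degree (T M) \<le> (\<Sum>j\<in>{a..<b}. degree (trunc_binom (m M j) (2^j)))"
      unfolding T_def using degree_prod_sum_le[of "{a..<b}" "\<lambda>j. trunc_binom (m M j) (2^j)"]
      by (simp add: o_def)
    also have "\<dots> \<le> (\<Sum>j\<in>{a..<b}. 2 ^ j)" by (intro sum_mono degree_trunc_binom)
    also have "\<dots> \<le> (\<Sum>j\<in>{..<b}. 2 ^ j)" by (intro sum_mono2) auto
    also have "\<dots> \<le> 2 ^ b" by (induction b) auto
    finally show ?thesis .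
  qed
  hence "degree (\<Sum>M<L. T M) \<le> 2 ^ b" by (intro degree_sum_le) auto
  hence deg: "degree q \<le> 2 ^ b" unfolding q_def using degree_smult_le order_trans by blast
  show ?thesis
  proof (rule that[OF L(4)])
    fix l assume "l \<le> degree q"
    hence l: "real l \<le> 2 ^ b" using deg by (metis le_trans of_nat_le_iff of_nat_numeral of_nat_power)
    have "norm (cis (2 * pi / real L) ^ l - 1) = norm (cis (real l * (2 * pi / real L)) - 1)"
      by (simp only: Complex.DeMoivre)
    also have "\<dots> \<le> \<bar>real l * (2 * pi / real L)\<bar>" by (rule norm_cis_minus_1_le)
    also have "\<dots> = real l * (2 * pi / real L)" by simp
    also have "\<dots> \<le> 2 ^ b * (2 * pi / real L)" using l by (intro mult_right_mono) auto
    also have "\<dots> \<le> \<delta>" using L(2,4) assms by (simp add: field_simps)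
    finally show "norm (cis (2 * pi / real L) ^ l - 1) \<le> \<delta>" .
  next
    fix n :: int
    define X where "X = cis (2 * pi * real_of_int n / real L)"
    have X: "norm X = 1" by (simp add: X_def)
    have wpos: "weight n > 0" by (rule weight_pos)
    have XL: "X ^ L = 1"
    proof -
      have "X ^ L = cis (2 * pi * real_of_int n)"
        unfolding X_def Complex.DeMoivre using L(4) by simp
      thus ?thesis by (simp add: cis_multiple_2pi)
    qed
    have 1: "norm (X ^ M - poly (T M) X) \<le> \<epsilon> / 2 * weight n" if M: "M < L" for M
    proof -
      have "norm (X ^ (\<Sum>j\<in>{a..<b}. m M j) - (\<Prod>j\<in>{a..<b}. poly (trunc_binom (m M j) (2^j)) X))
        \<le> 2 * (1 / 2) ^ a * weight n"
      proof (rule prod_trunc_binom_approx[OF a(1) b(1) X])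
        fix j assume j: "j \<in> {a..<b}"
        have "norm (X - 1) \<le> 2 * pi * real_of_int \<bar>n\<bar> / real L"
          unfolding X_def using norm_cis_minus_1_le[of "2 * pi * real_of_int n / real L"]
          by (simp add: abs_mult)
        hence "real (m M j) * norm (X - 1) \<le> 2 * real L / (C * real j) * (2 * pi * real_of_int \<bar>n\<bar> / real L)"
          using m(1)[OF M, of j] B_le[of j] C by (intro mult_mono) auto
        also have "\<dots> = real_of_int \<bar>n\<bar> / 152 / real j"
          using L(4) j a by (simp add: C_def field_simps)
        finally show "real (m M j) * norm (X - 1) \<le> real_of_int \<bar>n\<bar> / 152 / real j" .
      qed
      also have "\<dots> \<le> \<epsilon> / 2 * weight n" using a(2) wpos by (intro mult_right_mono) auto
      finally show ?thesis using m(2)[OF M] by (simp add: T_def poly_prod)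
    qed
    have "norm (poly q X - (1 / of_nat L) * (\<Sum>M<L. X ^ M)) = norm ((1 / of_nat L) * (\<Sum>M<L. X ^ M - poly (T M) X))"
      by (simp add: q_def poly_sum sum_subtractf right_diff_distrib norm_minus_commute)
    also have "\<dots> \<le> (1 / real L) * (\<Sum>M<L. \<epsilon> / 2 * weight n)"
      unfolding norm_mult using 1 by (intro mult_mono sum_norm_le) (auto simp: norm_divide)
    also have "\<dots> = \<epsilon> / 2 * weight n" using L(4) by simp
    finally have 2: "norm (poly q X - (1 / of_nat L) * (\<Sum>M<L. X ^ M)) \<le> \<epsilon> / 2 * weight n" .
    have 3: "norm ((1 / of_nat L) * (\<Sum>M<L. X ^ M) - of_bool (n = 0)) \<le> \<epsilon> / 2 * weight n"
    proof (cases "X = 1")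
      case False
      hence "(\<Sum>M<L. X ^ M) = 0" using XL by (simp add: sum_gp_strict)
      moreover have "n \<noteq> 0" using False by (auto simp: X_def)
      ultimately show ?thesis using wpos assms by simp
    next
      case True
      hence dvd: "int L dvd n" using cis_root_eq_1_dvd L(4) by (simp add: X_def)
      show ?thesis
      proof (cases "n = 0")
        case True
        thus ?thesis using \<open>X = 1\<close> L(4) wpos assms by simp
      next
        case False
        hence "weight (int L) \<le> weight n"
          using dvd dvd_imp_le_int[of n "int L"] by (intro weight_mono) auto
        hence "2 / \<epsilon> \<le> weight n" using L(1) by linarith
        hence "1 \<le> \<epsilon> / 2 * weight n" using assms by (simp add: field_simps)
        thus ?thesis using False True L(4) by simp
      qed
    qed
    have "norm (poly q X - of_bool (n = 0)) \<le> \<epsilon> / 2 * weight n + \<epsilon> / 2 * weight n"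
      using norm_triangle_mono[OF 2 3] by simp
    thus "norm (poly q (cis (2 * pi * real_of_int n / real L)) - of_bool (n = 0)) \<le> \<epsilon> * weight n"
      by (simp add: X_def)
  qed
qed

subsection \<open>Trigonometric polynomials concentrated on a small arc\<close>

lemma trig_partial_sum_cong:
  assumes "\<And>j. \<bar>j\<bar> \<le> int n \<Longrightarrow> a j = b j"
  shows "trig_partial_sum a n z = trig_partial_sum b n z"
  unfolding trig_partial_sum_def using assms by (intro sum.cong) auto

lemma trig_partial_sum_extend:
  assumes "n \<le> m" "\<And>j. \<bar>j\<bar> > int n \<Longrightarrow> a j = 0"
  shows "trig_partial_sum a m z = trig_partial_sum a n z"
  unfolding trig_partial_sum_def using assms by (intro sum.mono_neutral_right) auto

lemma trig_partial_sum_add: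
  "trig_partial_sum (\<lambda>j. a j + b j) n z = trig_partial_sum a n z + trig_partial_sum b n z"
  by (simp add: trig_partial_sum_def distrib_right sum.distrib)

lemma trig_partial_sum_diff:
  "trig_partial_sum (\<lambda>j. a j - b j) n z = trig_partial_sum a n z - trig_partial_sum b n z"
  by (simp add: trig_partial_sum_def left_diff_distrib sum_subtractf)

lemma norm_trig_partial_sum_le:
  assumes "norm z = 1"
  shows "norm (trig_partial_sum a n z) \<le> (\<Sum>j\<in>{- int n..int n}. norm (a j))"
  unfolding trig_partial_sum_def
  by (rule sum_norm_le) (simp add: norm_mult norm_power_int assms)

text \<open>For positive \<open>m\<close> this is \<open>1 - |n| / m\<close> if
  \<open>|n| \<le> m\<close> and 0 otherwise. Counting pairs makes the factorisation of the kernel a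
  regrouping of terms.\<close>

definition fejer_coeff :: "nat \<Rightarrow> int \<Rightarrow> real" where
  "fejer_coeff m n = real (card {(j, l). j < m \<and> l < m \<and> int j - int l = n}) / real m"

lemma card_diff_le: "card {(j, l). j < m \<and> l < m \<and> int j - int l = n} \<le> m"
proof -
  have "card {(j, l). j < m \<and> l < m \<and> int j - int l = n} \<le> card {..<m}"
    by (rule card_inj_on_le[where f = fst]) (auto simp: inj_on_def)
  thus ?thesis by simp
qed

lemma fejer_coeff_bounds: "0 \<le> fejer_coeff m n" "fejer_coeff m n \<le> 1"
  using card_diff_le[of m n] by (auto simp: fejer_coeff_def divide_le_eq_1)

lemma fejer_coeff_0: "m > 0 \<Longrightarrow> fejer_coeff m 0 = 1"
proof -
  assume m: "m > 0"
  have "{(j, l). j < m \<and> l < m \<and> int j - int l = 0} = (\<lambda>j. (j, j)) ` {..<m}" by auto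
  hence "card {(j, l). j < m \<and> l < m \<and> int j - int l = 0} = m"
    by (simp add: card_image inj_on_def)
  thus ?thesis using m by (simp add: fejer_coeff_def)
qed

lemma fejer_coeff_eq_0: "fejer_coeff m n = 0" if "\<bar>n\<bar> > int m"
proof -
  have "{(j, l). j < m \<and> l < m \<and> int j - int l = n} = {}" using that by auto
  thus ?thesis by (simp only: fejer_coeff_def card.empty of_nat_0 div_0)
qed

text \<open>On the circle \<open>cnj z\<close> is the inverse of \<open>z\<close>, and
  \<open>fejer_coeff\<close> counts how often each exponent \<open>j - l\<close> occurs in the
  product. The two geometric sums are bounded away from 1, so the kernel decays there like
  \<open>1 / m\<close>.\<close>

lemma fejer_sum:
  fixes z :: complex
  assumes "m > 0" "norm z = 1"
  shows "(\<Sum>n\<in>{- int m..int m}. of_real (fejer_coeff m n) * z powi n) =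
    (\<Sum>j<m. z ^ j) * (\<Sum>l<m. cnj z ^ l) / of_nat m"
proof -
  have z: "z \<noteq> 0" using assms by auto
  have zc: "cnj z = inverse z" using assms by (simp add: inverse_complex_def cnj_def complex_eq_iff cmod_def)
  have "(\<Sum>j<m. z ^ j) * (\<Sum>l<m. cnj z ^ l) = (\<Sum>(j, l)\<in>{..<m}\<times>{..<m}. z ^ j * cnj z ^ l)"
    by (simp add: sum_product sum.cartesian_product)
  also have "\<dots> = (\<Sum>(j, l)\<in>{..<m}\<times>{..<m}. z powi (int j - int l))"
    using z unfolding zc by (intro sum.cong refl) (auto simp: power_int_diff field_simps)
  also have "\<dots> = (\<Sum>n\<in>{- int m..int m}. \<Sum>(j, l) | (j, l) \<in> {..<m}\<times>{..<m} \<and> int j - int l = n. z powi (int j - int l))"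
    by (subst sum.group[symmetric, where g = "\<lambda>(j, l). int j - int l" and T = "{- int m..int m}"])
       (auto simp: case_prod_unfold simp del: sum_constant intro!: sum.cong)
  also have "\<dots> = (\<Sum>n\<in>{- int m..int m}. of_nat m * (of_real (fejer_coeff m n) * z powi n))"
  proof (rule sum.cong[OF refl])
    fix n
    have "(\<Sum>(j, l) | (j, l) \<in> {..<m}\<times>{..<m} \<and> int j - int l = n. z powi (int j - int l)) =
      (\<Sum>_ \<in> {(j, l). j < m \<and> l < m \<and> int j - int l = n}. z powi n)"
      by (intro sum.cong) auto
    thus "(\<Sum>(j, l) | (j, l) \<in> {..<m}\<times>{..<m} \<and> int j - int l = n. z powi (int j - int l)) =
      of_nat m * (of_real (fejer_coeff m n) * z powi n)"
      using assms by (simp add: fejer_coeff_def)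
  qed
  finally show ?thesis using assms by (simp add: sum_distrib_left[symmetric])
qed

lemma norm_geometric_sum_le:
  fixes z :: complex
  assumes "norm z = 1" "norm (z - 1) \<ge> d" "d > 0"
  shows "norm (\<Sum>j<m. z ^ j) \<le> 2 / d"
proof -
  have z: "z \<noteq> 1" using assms by auto
  have "norm (1 - z ^ m) \<le> 2"
    using norm_triangle_ineq4[of 1 "z ^ m"] assms by (simp add: norm_power)
  hence "norm (1 - z ^ m) / norm (1 - z) \<le> 2 / d"
    using assms by (intro frac_le) (auto simp: norm_minus_commute)
  thus ?thesis using z by (simp add: sum_gp_strict norm_divide)
qed

lemma norm_fejer_sum_le:
  fixes z :: complex
  assumes "m > 0" "norm z = 1" "norm (z - 1) \<ge> d" "d > 0"
  shows "norm (\<Sum>n\<in>{- int m..int m}. of_real (fejer_coeff m n) * z powi n) \<le> 4 / d\<^sup>2 / real m"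
proof -
  have c: "norm (cnj z - 1) = norm (z - 1)"
    by (metis complex_cnj_diff complex_cnj_one complex_mod_cnj)
  have g: "norm (\<Sum>l<m. cnj z ^ l) \<le> 2 / d"
    by (rule norm_geometric_sum_le) (use assms in \<open>simp_all add: c\<close>)
  have "norm (\<Sum>j<m. z ^ j) * norm (\<Sum>l<m. cnj z ^ l) \<le> (2 / d) * (2 / d)"
    using assms by (intro mult_mono g norm_geometric_sum_le) auto
  hence "norm (\<Sum>j<m. z ^ j) * norm (\<Sum>l<m. cnj z ^ l) / real m \<le> (2 / d) * (2 / d) / real m"
    by (rule divide_right_mono) simp
  thus ?thesis unfolding fejer_sum[OF assms(1,2)] norm_divide norm_mult
    by (simp add: power2_eq_square)
qed

text \<open>\<open>P\<close> is a combination of Fejer kernels centred at the inverses of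
  \<open>w ^ l\<close>, which lie within \<open>\<delta> / 2\<close> of 1, so off the arc all of
  them are small. The Fejer factors lie between 0 and 1 and equal 1 at frequency 0, so they preserve
  the coefficient estimate.\<close>

lemma trig_poly_concentrated:
  fixes \<epsilon> \<delta> :: real
  assumes "\<epsilon> > 0" "\<delta> > 0"
  obtains P :: "int \<Rightarrow> complex" and m :: nat where
    "\<And>n. \<bar>n\<bar> > int m \<Longrightarrow> P n = 0"
    "\<And>n. norm (P n - of_bool (n = 0)) \<le> \<epsilon> * weight n"
    "\<And>z. norm z = 1 \<Longrightarrow> norm (z - 1) \<ge> \<delta> \<Longrightarrow> norm (trig_partial_sum P m z) \<le> \<epsilon>"
proof -
  obtain L :: nat and q :: "complex poly" where Lq:
    "L > 0"
    "\<And>l. l \<le> degree q \<Longrightarrow> norm (cis (2 * pi / real L) ^ l - 1) \<le> \<delta> / 2"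
    "\<And>n::int. norm (poly q (cis (2 * pi * real_of_int n / real L)) - of_bool (n = 0)) \<le> \<epsilon> * weight n"
    using approx_delta_poly[of \<epsilon> "\<delta> / 2"] assms by auto
  define w where "w = cis (2 * pi / real L)"
  have w: "norm w = 1" "w \<noteq> 0" by (auto simp: w_def)
  have wn: "cis (2 * pi * real_of_int n / real L) = w powi n" for n
    by (simp add: w_def cis_power_int mult_ac)
  define A where "A = (\<Sum>l\<le>degree q. norm (coeff q l))"
  \<comment> \<open>The order \<open>m\<close> is chosen after \<open>q\<close>, so the decay of the
    kernels beats the coefficient sum \<open>A\<close>, however large.\<close>
  have "eventually (\<lambda>m::nat. A * (4 / (\<delta> / 2)\<^sup>2 / real m) \<le> \<epsilon>) sequentially"
    using assms by real_asymp
  hence "eventually (\<lambda>m::nat. A * (4 / (\<delta> / 2)\<^sup>2 / real m) \<le> \<epsilon> \<and> m > 0) sequentially"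
    using eventually_gt_at_top[of 0] by eventually_elim auto
  then obtain m :: nat where m: "A * (4 / (\<delta> / 2)\<^sup>2 / real m) \<le> \<epsilon>" "m > 0"
    by (auto simp: eventually_at_top_linorder)
  define P where "P = (\<lambda>n. of_real (fejer_coeff m n) * poly q (w powi n))"
  show ?thesis
  proof (rule that)
    fix n :: int assume "\<bar>n\<bar> > int m"
    thus "P n = 0" by (simp add: P_def fejer_coeff_eq_0)
  next
    fix n :: int
    show "norm (P n - of_bool (n = 0)) \<le> \<epsilon> * weight n"
    proof (cases "n = 0")
      case True
      thus ?thesis using Lq(3)[of 0] m(2) by (simp add: P_def fejer_coeff_0)
    next
      case False
      have "norm (P n) = fejer_coeff m n * norm (poly q (w powi n))"
        using fejer_coeff_bounds[of m n] by (simp add: P_def norm_mult)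
      also have "\<dots> \<le> 1 * norm (poly q (w powi n))"
        using fejer_coeff_bounds[of m n] by (intro mult_right_mono) auto
      also have "\<dots> \<le> \<epsilon> * weight n" using Lq(3)[of n] False by (simp add: wn)
      finally show ?thesis using False by simp
    qed
  next
    fix z :: complex assume z: "norm z = 1" "norm (z - 1) \<ge> \<delta>"
    have "trig_partial_sum P m z =
      (\<Sum>n\<in>{- int m..int m}. \<Sum>l\<le>degree q. coeff q l * (of_real (fejer_coeff m n) * (w ^ l * z) powi n))"
      unfolding trig_partial_sum_def P_def
      by (intro sum.cong refl)
         (simp add: poly_altdef sum_distrib_left sum_distrib_right power_int_mult_distrib
            power_int_mult[symmetric] mult_ac flip: power_int_of_nat)
    also have "\<dots> = (\<Sum>l\<le>degree q. coeff q l *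
        (\<Sum>n\<in>{- int m..int m}. of_real (fejer_coeff m n) * (w ^ l * z) powi n))"
      by (subst sum.swap) (simp add: sum_distrib_left)
    also have "norm \<dots> \<le> (\<Sum>l\<le>degree q. norm (coeff q l) * (4 / (\<delta> / 2)\<^sup>2 / real m))"
    proof (rule sum_norm_le)
      fix l assume l: "l \<in> {..degree q}"
      have "norm (w ^ l - 1) \<le> \<delta> / 2" using Lq(2)[of l] l by (simp add: w_def)
      moreover have "norm (w ^ l * z - z) = norm (w ^ l - 1)"
      proof -
        have "w ^ l * z - z = (w ^ l - 1) * z" by (simp add: algebra_simps)
        thus ?thesis using z by (simp add: norm_mult)
      qed
      moreover have "norm (z - 1) \<le> norm (w ^ l * z - 1) + norm (w ^ l * z - z)"
        using norm_triangle_ineq4[of "w ^ l * z - 1" "w ^ l * z - z"] by simp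
      ultimately have "norm (w ^ l * z - 1) \<ge> \<delta> / 2" using z by linarith
      hence "norm (\<Sum>n\<in>{- int m..int m}. of_real (fejer_coeff m n) * (w ^ l * z) powi n) \<le> 4 / (\<delta> / 2)\<^sup>2 / real m"
        using m z w assms by (intro norm_fejer_sum_le) (auto simp: norm_mult norm_power)
      thus "norm (coeff q l * (\<Sum>n\<in>{- int m..int m}. of_real (fejer_coeff m n) * (w ^ l * z) powi n))
          \<le> norm (coeff q l) * (4 / (\<delta> / 2)\<^sup>2 / real m)"
        unfolding norm_mult by (intro mult_left_mono) auto
    qed
    also have "\<dots> = A * (4 / (\<delta> / 2)\<^sup>2 / real m)" by (simp only: A_def sum_distrib_right)
    also have "\<dots> \<le> \<epsilon>" by (rule m(1))
    finally show "norm (trig_partial_sum P m z) \<le> \<epsilon>" .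
  qed
qed

section \<open>Construction of a single block\<close>

lemma trig_partial_sum_convolution:
  fixes g d :: "int \<Rightarrow> complex"
  assumes d: "\<And>j. \<bar>j\<bar> > int m \<Longrightarrow> d j = 0" and z: "z \<noteq> 0"
  shows "trig_partial_sum (\<lambda>n. \<Sum>k\<in>{- int r..int r}. g k * d (n - k)) (m + r) z =
    trig_partial_sum g r z * trig_partial_sum d m z"
proof -
  let ?I = "{- int (m + r)..int (m + r)}" and ?R = "{- int r..int r}"
  have "trig_partial_sum (\<lambda>n. \<Sum>k\<in>?R. g k * d (n - k)) (m + r) z =
      (\<Sum>k\<in>?R. \<Sum>n\<in>?I. g k * z powi k * (d (n - k) * z powi (n - k)))"
    unfolding trig_partial_sum_def sum_distrib_right
    by (subst sum.swap) (use z in \<open>auto intro!: sum.cong simp: power_int_diff\<close>)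
  also have "\<dots> = (\<Sum>k\<in>?R. g k * z powi k * trig_partial_sum d m z)"
  proof (rule sum.cong[OF refl])
    fix k assume k: "k \<in> ?R"
    have "(\<Sum>n\<in>?I. d (n - k) * z powi (n - k)) = (\<Sum>n\<in>(\<lambda>n. n - k) ` ?I. d n * z powi n)"
      by (subst sum.reindex) (auto simp: inj_on_def)
    also have "\<dots> = trig_partial_sum d m z"
      unfolding trig_partial_sum_def
    proof (rule sum.mono_neutral_right)
      show "{- int m..int m} \<subseteq> (\<lambda>n. n - k) ` ?I"
        using k by (auto simp: image_iff intro!: bexI[of _ "_ + k"])
    qed (auto simp: d)
    finally show "(\<Sum>n\<in>?I. g k * z powi k * (d (n - k) * z powi (n - k))) =
        g k * z powi k * trig_partial_sum d m z"
      by (simp only: sum_distrib_left[symmetric])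
  qed
  also have "\<dots> = trig_partial_sum g r z * trig_partial_sum d m z"
    by (simp add: trig_partial_sum_def sum_distrib_right)
  finally show ?thesis .
qed

text \<open>The block is \<open>g\<close> times \<open>1 - P (z / \<zeta>)\<close> with the
  frequencies up to \<open>N\<close> removed. Its coefficients, relative to \<open>weight\<close>,
  and both errors (from \<open>P\<close> off the arc, from the removal) are at most
  \<open>\<eta>\<close> times constants that depend on \<open>g\<close>, \<open>r\<close> and
  \<open>N\<close> only.\<close>

lemma trig_poly_stage:
  fixes \<epsilon> \<delta> :: real and g :: "int \<Rightarrow> complex" and r N :: nat
  assumes "\<epsilon> > 0" "\<delta> > 0" and \<zeta>: "norm \<zeta> = 1"
  obtains p :: "int \<Rightarrow> complex" and m :: nat where
    "m > N"
    "\<And>n. \<bar>n\<bar> \<le> int N \<Longrightarrow> p n = 0" "\<And>n. \<bar>n\<bar> > int m \<Longrightarrow> p n = 0"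
    "\<And>n. norm (p n) \<le> \<epsilon> * weight n"
    "\<And>z. norm z = 1 \<Longrightarrow> norm (z - \<zeta>) \<ge> \<delta> \<Longrightarrow> norm (trig_partial_sum p m z - trig_partial_sum g r z) \<le> \<epsilon>"
proof -
  define R where "R = {- int r..int r}"
  define C where "C = (\<Sum>k\<in>R. norm (g k) * exp (real_of_int \<bar>k\<bar>))"
  define G where "G = (\<Sum>k\<in>R. norm (g k))"
  define S where "S = (\<Sum>n\<in>{- int N..int N}. weight n)"
  have nn: "C \<ge> 0" "G \<ge> 0" "S \<ge> 0"
    by (auto simp: C_def G_def S_def intro!: sum_nonneg less_imp_le[OF weight_pos])
  \<comment> \<open>\<open>C\<close> bounds the coefficients and \<open>G + C * S\<close> the total
    error; the summand 1 keeps the divisor positive.\<close>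
  define D where "D = 1 + C + G + C * S"
  have D: "D \<ge> 1" "C \<le> D" "G + C * S \<le> D" using nn by (auto simp: D_def)
  define \<eta> where "\<eta> = \<epsilon> / D"
  have \<eta>: "\<eta> > 0" "\<eta> * D = \<epsilon>" using assms D by (auto simp: \<eta>_def)
  obtain P :: "int \<Rightarrow> complex" and m0 :: nat where P:
    "\<And>n. \<bar>n\<bar> > int m0 \<Longrightarrow> P n = 0"
    "\<And>n. norm (P n - of_bool (n = 0)) \<le> \<eta> * weight n"
    "\<And>z. norm z = 1 \<Longrightarrow> norm (z - 1) \<ge> \<delta> \<Longrightarrow> norm (trig_partial_sum P m0 z) \<le> \<eta>"
    using trig_poly_concentrated[OF \<eta>(1) assms(2)] by metis
  have \<zeta>0: "\<zeta> \<noteq> 0" using \<zeta> by auto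
  \<comment> \<open>Division by \<open>\<zeta> powi n\<close> moves the concentration point from 1
    to \<open>\<zeta>\<close> without changing moduli.\<close>
  define d where "d = (\<lambda>n. of_bool (n = 0) - P n / \<zeta> powi n)"
  define h where "h = (\<lambda>n. \<Sum>k\<in>R. g k * d (n - k))"
  define p where "p = (\<lambda>n. if \<bar>n\<bar> \<le> int N then 0 else h n)"
  define m where "m = m0 + r + N + 1"
  have d0: "d j = 0" if "\<bar>j\<bar> > int m0" for j using that P(1)[of j] by (auto simp: d_def)
  have d_le: "norm (d n) \<le> \<eta> * weight n" for n
  proof -
    have "norm (d n) = norm (P n - of_bool (n = 0))"
      using \<zeta> by (cases "n = 0") (auto simp: d_def norm_divide norm_power_int norm_minus_commute)
    thus ?thesis using P(2) by simp
  qed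
  have h0: "h n = 0" if "\<bar>n\<bar> > int (m0 + r)" for n
    unfolding h_def by (rule sum.neutral) (use that in \<open>auto simp: R_def d0\<close>)
  have h_le: "norm (h n) \<le> \<eta> * C * weight n" for n
  proof -
    have "norm (h n) \<le> (\<Sum>k\<in>R. norm (g k) * (\<eta> * (exp (real_of_int \<bar>k\<bar>) * weight n)))"
      unfolding h_def
    proof (rule sum_norm_le)
      fix k
      have "norm (d (n - k)) \<le> \<eta> * weight (n - k)" by (rule d_le)
      also have "\<dots> \<le> \<eta> * (exp (real_of_int \<bar>k\<bar>) * weight n)"
        using \<eta> by (intro mult_left_mono weight_diff_le) auto
      finally show "norm (g k * d (n - k)) \<le> norm (g k) * (\<eta> * (exp (real_of_int \<bar>k\<bar>) * weight n))"
        unfolding norm_mult by (intro mult_left_mono) auto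
    qed
    also have "\<dots> = \<eta> * C * weight n"
      by (simp add: C_def sum_distrib_left sum_distrib_right mult_ac)
    finally show ?thesis .
  qed
  show ?thesis
  proof (rule that)
    show "m > N" by (simp add: m_def)
    show "p n = 0" if "\<bar>n\<bar> \<le> int N" for n using that by (simp add: p_def)
    show "p n = 0" if "\<bar>n\<bar> > int m" for n using that h0[of n] by (simp add: p_def m_def)
    show "norm (p n) \<le> \<epsilon> * weight n" for n
    proof -
      have "norm (p n) \<le> norm (h n)" by (simp add: p_def)
      also have "\<dots> \<le> \<eta> * C * weight n" by (rule h_le)
      also have "\<dots> \<le> \<eta> * D * weight n"
        using \<eta> D weight_pos[of n] by (intro mult_right_mono mult_left_mono) auto
      finally show ?thesis using \<eta> by simp
    qed
    fix z :: complex assume z: "norm z = 1" "norm (z - \<zeta>) \<ge> \<delta>"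
    have z0: "z \<noteq> 0" using z by auto
    have "trig_partial_sum h m z = trig_partial_sum h (m0 + r) z"
      by (rule trig_partial_sum_extend) (auto simp: m_def h0)
    also have "\<dots> = trig_partial_sum g r z * trig_partial_sum d m0 z"
      unfolding h_def R_def by (rule trig_partial_sum_convolution[OF d0 z0])
    also have "trig_partial_sum d m0 z = 1 - trig_partial_sum P m0 (z / \<zeta>)"
    proof -
      have "trig_partial_sum (\<lambda>n. of_bool (n = 0)) m0 z = (\<Sum>j\<in>{0}. of_bool (j = 0) * z powi j)"
        unfolding trig_partial_sum_def by (rule sum.mono_neutral_right) auto
      hence "trig_partial_sum (\<lambda>n. of_bool (n = 0)) m0 z = 1" by simp
      moreover have "trig_partial_sum (\<lambda>n. P n / \<zeta> powi n) m0 z = trig_partial_sum P m0 (z / \<zeta>)"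
        by (simp add: trig_partial_sum_def power_int_divide_distrib)
      ultimately show ?thesis unfolding d_def trig_partial_sum_diff by simp
    qed
    finally have h_eq: "trig_partial_sum h m z - trig_partial_sum g r z =
        - (trig_partial_sum g r z * trig_partial_sum P m0 (z / \<zeta>))"
      by (simp add: algebra_simps)
    have "norm (trig_partial_sum P m0 (z / \<zeta>)) \<le> \<eta>"
    proof (rule P(3))
      have "z / \<zeta> - 1 = (z - \<zeta>) / \<zeta>" using \<zeta>0 by (simp add: field_simps)
      thus "norm (z / \<zeta> - 1) \<ge> \<delta>" using z \<zeta> by (simp add: norm_divide)
    qed (use z \<zeta> in \<open>simp add: norm_divide\<close>)
    hence 1: "norm (trig_partial_sum h m z - trig_partial_sum g r z) \<le> G * \<eta>"
      unfolding h_eq norm_minus_cancel norm_mult using z nn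
      by (intro mult_mono) (auto simp: G_def R_def norm_trig_partial_sum_le)
    have "norm (trig_partial_sum p m z - trig_partial_sum h m z) =
        norm (trig_partial_sum (\<lambda>n. p n - h n) m z)" by (simp add: trig_partial_sum_diff)
    also have "\<dots> \<le> (\<Sum>n\<in>{- int m..int m}. norm (p n - h n))"
      by (rule norm_trig_partial_sum_le[OF z(1)])
    also have "\<dots> = (\<Sum>n\<in>{- int N..int N}. norm (h n))"
      by (rule sum.mono_neutral_cong_right) (auto simp: p_def m_def)
    also have "\<dots> \<le> (\<Sum>n\<in>{- int N..int N}. \<eta> * C * weight n)" by (intro sum_mono h_le)
    also have "\<dots> = \<eta> * C * S" by (simp add: S_def sum_distrib_left)
    finally have 2: "norm (trig_partial_sum p m z - trig_partial_sum h m z) \<le> \<eta> * C * S" .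
    have "norm (trig_partial_sum p m z - trig_partial_sum g r z) \<le> \<eta> * C * S + G * \<eta>"
      using norm_triangle_mono[OF 2 1] by simp
    also have "\<dots> = \<eta> * (G + C * S)" by (simp add: algebra_simps)
    also have "\<dots> \<le> \<eta> * D" using \<eta> D by (intro mult_left_mono) auto
    finally show "norm (trig_partial_sum p m z - trig_partial_sum g r z) \<le> \<epsilon>" using \<eta> by simp
  qed
qed

subsection \<open>A pointwise universal series\<close>

text \<open>The list holds the real and imaginary parts of the coefficients of
  \<open>- r, - r + 1, \<dots>, r\<close>.\<close>
definition rat_coeffs :: "nat \<times> (rat \<times> rat) list \<Rightarrow> int \<Rightarrow> complex" where
  "rat_coeffs = (\<lambda>(r, xs) j. if \<bar>j\<bar> \<le> int r \<and> nat (j + int r) < length xs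
     then Complex (of_rat (fst (xs ! nat (j + int r)))) (of_rat (snd (xs ! nat (j + int r)))) else 0)"

lemma rat_approx: "\<exists>q. \<bar>of_rat q - x\<bar> < e" if "e > 0" for x e :: real
proof -
  have "x < x + e" using that by simp
  then obtain q where "x < of_rat q" "of_rat q < x + e" using of_rat_dense by blast
  thus ?thesis by (intro exI[of _ q]) auto
qed

lemma rat_coeffs_approx:
  fixes g :: "int \<Rightarrow> complex"
  assumes "e > 0"
  shows "\<exists>xs. \<forall>j\<in>{- int r..int r}. norm (rat_coeffs (r, xs) j - g j) \<le> e"
proof -
  have "\<exists>q. norm (Complex (of_rat (fst q)) (of_rat (snd q)) - z) \<le> e" for z
  proof -
    obtain a b where ab: "\<bar>of_rat a - Re z\<bar> < e / 2" "\<bar>of_rat b - Im z\<bar> < e / 2"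
      using rat_approx[of "e/2"] assms by (metis half_gt_zero)
    have "norm (Complex (of_rat a) (of_rat b) - z) \<le> \<bar>of_rat a - Re z\<bar> + \<bar>of_rat b - Im z\<bar>"
      using cmod_le[of "Complex (of_rat a) (of_rat b) - z"] by simp
    thus ?thesis using ab by (intro exI[of _ "(a, b)"]) auto
  qed
  then obtain q where q: "\<And>z. norm (Complex (of_rat (fst (q z))) (of_rat (snd (q z))) - z) \<le> e"
    by metis
  show ?thesis
  proof (intro exI ballI)
    fix j assume j: "j \<in> {- int r..int r}"
    have "nat (j + int r) < 2 * r + 1" using j by auto
    thus "norm (rat_coeffs (r, map (\<lambda>i. q (g (int i - int r))) [0..<2 * r + 1]) j - g j) \<le> e"
      using j q[of "g j"] by (auto simp: rat_coeffs_def simp del: upt_Suc)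
  qed
qed

section \<open>Density of rational trigonometric polynomials\<close>

definition is_trig_poly :: "(complex \<Rightarrow> complex) \<Rightarrow> bool" where
  "is_trig_poly f \<longleftrightarrow> (\<exists>a r. (\<forall>j. \<bar>j\<bar> > int r \<longrightarrow> a j = 0) \<and> (\<forall>z\<in>sphere 0 1. f z = trig_partial_sum a r z))"

lemma is_trig_polyI:
  assumes "\<And>j. \<bar>j\<bar> > int r \<Longrightarrow> a j = 0" "\<And>z. z \<in> sphere 0 1 \<Longrightarrow> f z = trig_partial_sum a r z"
  shows "is_trig_poly f"
  unfolding is_trig_poly_def by (rule exI[of _ a], rule exI[of _ r]) (use assms in simp)

lemma is_trig_poly_const: "is_trig_poly (\<lambda>_. c)"
proof (rule is_trig_polyI)
  show "c = trig_partial_sum (\<lambda>j. if j = 0 then c else 0) 0 z" for z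
    by (simp add: trig_partial_sum_def)
qed auto

lemma is_trig_poly_add:
  assumes "is_trig_poly f" "is_trig_poly g"
  shows "is_trig_poly (\<lambda>z. f z + g z)"
proof -
  obtain r a where "(\<forall>j. \<bar>j\<bar> > int r \<longrightarrow> a j = 0) \<and> (\<forall>z\<in>sphere 0 1. f z = trig_partial_sum a r z)"
    using assms(1) unfolding is_trig_poly_def by (elim exE) (rule that)
  hence f: "\<And>j. \<bar>j\<bar> > int r \<Longrightarrow> a j = 0" "\<And>z. z \<in> sphere 0 1 \<Longrightarrow> f z = trig_partial_sum a r z"
    by simp_all
  obtain s b where "(\<forall>j. \<bar>j\<bar> > int s \<longrightarrow> b j = 0) \<and> (\<forall>z\<in>sphere 0 1. g z = trig_partial_sum b s z)"
    using assms(2) unfolding is_trig_poly_def by (elim exE) (rule that)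
  hence g: "\<And>j. \<bar>j\<bar> > int s \<Longrightarrow> b j = 0" "\<And>z. z \<in> sphere 0 1 \<Longrightarrow> g z = trig_partial_sum b s z"
    by simp_all
  note * = f g
  have "f z + g z = trig_partial_sum (\<lambda>j. a j + b j) (max r s) z" if "z \<in> sphere 0 1" for z
    using that * trig_partial_sum_extend[of r "max r s" a z] trig_partial_sum_extend[of s "max r s" b z]
    by (simp add: trig_partial_sum_add)
  moreover have "a j + b j = 0" if "\<bar>j\<bar> > int (max r s)" for j using *(1,3)[of j] that by auto
  ultimately show ?thesis by (rule is_trig_polyI[rotated])
qed

lemma is_trig_poly_mult:
  assumes "is_trig_poly f" "is_trig_poly g"
  shows "is_trig_poly (\<lambda>z. f z * g z)"
proof -
  obtain r a where "(\<forall>j. \<bar>j\<bar> > int r \<longrightarrow> a j = 0) \<and> (\<forall>z\<in>sphere 0 1. f z = trig_partial_sum a r z)"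
    using assms(1) unfolding is_trig_poly_def by (elim exE) (rule that)
  hence f: "\<And>j. \<bar>j\<bar> > int r \<Longrightarrow> a j = 0" "\<And>z. z \<in> sphere 0 1 \<Longrightarrow> f z = trig_partial_sum a r z"
    by simp_all
  obtain s b where "(\<forall>j. \<bar>j\<bar> > int s \<longrightarrow> b j = 0) \<and> (\<forall>z\<in>sphere 0 1. g z = trig_partial_sum b s z)"
    using assms(2) unfolding is_trig_poly_def by (elim exE) (rule that)
  hence g: "\<And>j. \<bar>j\<bar> > int s \<Longrightarrow> b j = 0" "\<And>z. z \<in> sphere 0 1 \<Longrightarrow> g z = trig_partial_sum b s z"
    by simp_all
  note * = f g
  define c where "c = (\<lambda>n. \<Sum>k\<in>{- int r..int r}. a k * b (n - k))"
  have "f z * g z = trig_partial_sum c (s + r) z" if "z \<in> sphere 0 1" for z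
    using that * trig_partial_sum_convolution[of s b z a r] unfolding c_def by fastforce
  moreover have "c j = 0" if "\<bar>j\<bar> > int (s + r)" for j
    unfolding c_def by (rule sum.neutral) (use that *(3) in auto)
  ultimately show ?thesis by (rule is_trig_polyI[rotated])
qed

text \<open>On the circle \<open>inverse z = cnj z\<close>, so the frequencies 1 and -1 suffice;
  this is why \<open>is_trig_poly\<close> demands agreement on the circle only.\<close>

lemma is_trig_poly_Re_Im: "is_trig_poly (\<lambda>z. of_real (Re z))" "is_trig_poly (\<lambda>z. of_real (Im z))"
proof -
  have s: "{- int 1..int 1} = {-1, 0, 1}" by auto
  have zc: "inverse z = cnj z" if "z \<in> sphere 0 1" for z
    using that by (simp add: complex_eq_iff cmod_def)
  show "is_trig_poly (\<lambda>z. of_real (Re z))"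
  proof (rule is_trig_polyI)
    show "of_real (Re z) = trig_partial_sum (\<lambda>j. if \<bar>j\<bar> = 1 then 1/2 else 0) 1 z" if "z \<in> sphere 0 1" for z
      unfolding trig_partial_sum_def s by (simp add: power_int_minus zc[OF that] complex_eq_iff)
  qed auto
  show "is_trig_poly (\<lambda>z. of_real (Im z))"
  proof (rule is_trig_polyI)
    show "of_real (Im z) = trig_partial_sum (\<lambda>j. if j = 1 then - \<i>/2 else if j = -1 then \<i>/2 else 0) 1 z"
      if "z \<in> sphere 0 1" for z
      unfolding trig_partial_sum_def s by (simp add: power_int_minus zc[OF that] complex_eq_iff)
  qed auto
qed

lemma is_trig_poly_real_polynomial:
  "real_polynomial_function p \<Longrightarrow> is_trig_poly (\<lambda>z. of_real (p z))"
proof (induction rule: real_polynomial_function.induct)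
  case (linear f)
  have "complex_of_real (f z) = of_real (Re z) * of_real (f 1) + of_real (Im z) * of_real (f \<i>)" for z
  proof -
    interpret bounded_linear f by fact
    have "z = Re z *\<^sub>R 1 + Im z *\<^sub>R \<i>" by (simp add: complex_eq_iff)
    hence "f z = f (Re z *\<^sub>R 1 + Im z *\<^sub>R \<i>)" by (rule arg_cong)
    also have "\<dots> = Re z * f 1 + Im z * f \<i>" by (simp only: add scaleR real_scaleR_def)
    finally have "complex_of_real (f z) = of_real (Re z * f 1 + Im z * f \<i>)" by (rule arg_cong)
    thus ?thesis by (simp only: of_real_add of_real_mult)
  qed
  hence "(\<lambda>z. complex_of_real (f z)) = (\<lambda>z. of_real (Re z) * of_real (f 1) + of_real (Im z) * of_real (f \<i>))"
    by (rule ext)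
  thus ?case
    by (elim ssubst) (intro is_trig_poly_add is_trig_poly_mult is_trig_poly_Re_Im is_trig_poly_const)
qed (simp_all add: is_trig_poly_const is_trig_poly_add is_trig_poly_mult)

lemma is_trig_poly_polynomial:
  fixes p :: "complex \<Rightarrow> complex"
  assumes "polynomial_function p"
  shows "is_trig_poly p"
proof -
  have P: "real_polynomial_function (F \<circ> p)" if "bounded_linear F" for F :: "complex \<Rightarrow> real"
    using assms that unfolding polynomial_function_def by (elim allE impE)
  have "real_polynomial_function (\<lambda>z. Re (p z))" "real_polynomial_function (\<lambda>z. Im (p z))"
    using P[OF bounded_linear_Re] P[OF bounded_linear_Im] by (simp_all only: o_def)
  hence "is_trig_poly (\<lambda>z. of_real (Re (p z)) + \<i> * of_real (Im (p z)))"
    by (intro is_trig_poly_add is_trig_poly_mult is_trig_poly_const is_trig_poly_real_polynomial)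
  moreover have "(\<lambda>z. of_real (Re (p z)) + \<i> * of_real (Im (p z))) = p"
    by (simp add: fun_eq_iff complex_eq_iff)
  ultimately show ?thesis by (simp only:)
qed

text \<open>Stone-Weierstrass gives a polynomial in the real and imaginary parts, which is a
  trigonometric polynomial on the circle. Rounding its \<open>2 * r + 1\<close> coefficients uses
  the other half of \<open>e\<close>.\<close>

lemma rat_trig_poly_dense:
  assumes "continuous_on (sphere 0 1) f" "e > 0"
  shows "\<exists>r xs. \<forall>z\<in>sphere 0 1. norm (trig_partial_sum (rat_coeffs (r, xs)) r z - f z) \<le> e"
proof -
  have "\<exists>p. polynomial_function p \<and> (\<forall>z\<in>sphere 0 1. norm (f z - p z) < e / 2)"
    by (rule Stone_Weierstrass_polynomial_function[OF compact_sphere assms(1) half_gt_zero[OF assms(2)]])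
  then obtain p where p: "polynomial_function p" and
    p_approx: "\<forall>z\<in>sphere 0 1. norm (f z - p z) < e / 2" by (elim exE conjE) (rule that)
  obtain r a where "(\<forall>j. \<bar>j\<bar> > int r \<longrightarrow> a j = 0) \<and> (\<forall>z\<in>sphere 0 1. p z = trig_partial_sum a r z)"
    using is_trig_poly_polynomial[OF p] unfolding is_trig_poly_def by (elim exE) (rule that)
  hence a: "\<And>z. z \<in> sphere 0 1 \<Longrightarrow> p z = trig_partial_sum a r z" by simp
  define e' where "e' = e / 2 / real (2 * r + 1)"
  have "e' > 0" using assms by (simp add: e'_def)
  then obtain xs where xs: "\<And>j. j \<in> {- int r..int r} \<Longrightarrow> norm (rat_coeffs (r, xs) j - a j) \<le> e'"
    using rat_coeffs_approx[of e' r a] by blast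
  show ?thesis
  proof (intro exI ballI)
    fix z :: complex assume z: "z \<in> sphere 0 1"
    have "norm (trig_partial_sum (rat_coeffs (r, xs)) r z - p z) =
        norm (trig_partial_sum (\<lambda>j. rat_coeffs (r, xs) j - a j) r z)"
      using a z by (simp add: trig_partial_sum_diff)
    also have "\<dots> \<le> (\<Sum>j\<in>{- int r..int r}. norm (rat_coeffs (r, xs) j - a j))"
      using z by (intro norm_trig_partial_sum_le) auto
    also have "\<dots> \<le> (\<Sum>j\<in>{- int r..int r}. e')" by (intro sum_mono xs)
    also have "\<dots> = e / 2" by (simp add: e'_def nat_add_distrib field_simps)
    finally have "norm (trig_partial_sum (rat_coeffs (r, xs)) r z - p z) \<le> e / 2" .
    moreover have "norm (p z - f z) \<le> e / 2" using bspec[OF p_approx z] by (simp add: norm_minus_commute less_imp_le)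
    ultimately show "norm (trig_partial_sum (rat_coeffs (r, xs)) r z - f z) \<le> e"
      using norm_triangle_mono by fastforce
  qed
qed

text \<open>The second component of the decoded pair is ignored; it makes every rational trigonometric
  polynomial occur infinitely often.\<close>
definition target :: "nat \<Rightarrow> nat \<times> (rat \<times> rat) list" where
  "target k = from_nat (fst (prod_decode k))"

lemma target_infinitely_often: "\<exists>k>K. target k = t"
proof -
  have "prod_encode (to_nat t, Suc K) > K"
    using le_prod_encode_2[of "Suc K" "to_nat t"] by linarith
  thus ?thesis by (intro exI[of _ "prod_encode (to_nat t, Suc K)"]) (simp add: target_def)
qed

text \<open>The open balls of radius \<open>norm (1 - centre k)\<close> around these points shrink to 1 without containing
  it, so every point of the circle lies in only finitely many of them.\<close>
definition centre :: "nat \<Rightarrow> complex" where "centre k = cis (1 / real (k + 1))"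

lemma norm_centre: "norm (centre k) = 1"
  by (simp add: centre_def)

lemma centre_neq_1: "centre k \<noteq> 1"
proof
  assume "centre k = 1"
  hence "cos (1 / real (k + 1)) = 1" by (simp add: centre_def complex_eq_iff)
  moreover have "1 / real (k + 1) \<le> 1" by simp
  hence "1 / real (k + 1) \<le> pi" using pi_gt3 by linarith
  hence "cos (1 / real (k + 1)) < cos 0" by (intro cos_monotone_0_pi) auto
  ultimately show False by simp
qed

lemma centre_tendsto: "centre \<longlonglongrightarrow> 1"
proof -
  have "(\<lambda>k. cis (1 / real (k + 1))) \<longlonglongrightarrow> cis 0"
    unfolding cis_conv_exp by (intro tendsto_intros) real_asymp
  thus ?thesis by (simp add: centre_def[abs_def])
qed

text \<open>At \<open>z = 1\<close> both sides agree; elsewhere the left side tends to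
  \<open>norm (z - 1) > 0\<close> and the right side to 0.\<close>

lemma eventually_outside_ball:
  "eventually (\<lambda>k. norm (z - centre k) \<ge> norm (1 - centre k)) sequentially"
proof (cases "z = 1")
  case False
  have "(\<lambda>k. norm (z - centre k) - norm (1 - centre k)) \<longlonglongrightarrow> norm (z - 1) - norm (1 - 1 :: complex)"
    by (intro tendsto_intros centre_tendsto)
  hence "eventually (\<lambda>k. norm (z - centre k) - norm (1 - centre k) > 0) sequentially"
    using False by (intro order_tendstoD(1)) auto
  thus ?thesis by eventually_elim simp
qed simp

text \<open>A block approximating \<open>rat_coeffs t - a\<close> is added. Its frequencies avoid
  the support of \<open>a\<close> and \<open>\<epsilon> \<le> 1\<close>, so the bound by
  \<open>weight\<close> survives with constant 1.\<close>

lemma universal_series_stage: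
  assumes "\<And>n. \<bar>n\<bar> > int N \<Longrightarrow> a n = 0" "\<And>n. norm (a n) \<le> weight n"
  shows "\<exists>a' N'. N' > N \<and> (\<forall>n. \<bar>n\<bar> \<le> int N \<longrightarrow> a' n = a n) \<and> (\<forall>n. \<bar>n\<bar> > int N' \<longrightarrow> a' n = 0) \<and>
    (\<forall>n. norm (a' n) \<le> weight n) \<and>
    (\<forall>z. norm z = 1 \<longrightarrow> norm (z - centre k) \<ge> norm (1 - centre k) \<longrightarrow>
      norm (trig_partial_sum a' N' z - trig_partial_sum (rat_coeffs t) (fst t) z) \<le> 1 / real (k + 1))"
proof -
  \<comment> \<open>Neither \<open>a\<close> nor the target has frequencies beyond \<open>M\<close>,
    so the partial sum of order \<open>M\<close> is the whole correction.\<close>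
  define M where "M = max N (fst t)"
  define g where "g = (\<lambda>n. rat_coeffs t n - a n)"
  define \<epsilon> where "\<epsilon> = 1 / real (k + 1)"
  have \<epsilon>: "\<epsilon> > 0" "\<epsilon> \<le> 1" by (auto simp: \<epsilon>_def)
  have \<delta>: "norm (1 - centre k) > 0" using centre_neq_1[of k] by simp
  obtain p m where p: "m > N" "\<And>n. \<bar>n\<bar> \<le> int N \<Longrightarrow> p n = 0" "\<And>n. \<bar>n\<bar> > int m \<Longrightarrow> p n = 0"
    "\<And>n. norm (p n) \<le> \<epsilon> * weight n"
    "\<And>z. norm z = 1 \<Longrightarrow> norm (z - centre k) \<ge> norm (1 - centre k) \<Longrightarrow>
      norm (trig_partial_sum p m z - trig_partial_sum g M z) \<le> \<epsilon>"
    using trig_poly_stage[OF \<epsilon>(1) \<delta> norm_centre, where N = N and g = g and r = M] by metis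
  have t0: "rat_coeffs t n = 0" if "\<bar>n\<bar> > int (fst t)" for n
    using that by (auto simp: rat_coeffs_def case_prod_unfold)
  define a' where "a' = (\<lambda>n. a n + p n)"
  show ?thesis
  proof (intro exI[of _ a'] exI[of _ m] conjI allI impI)
    show "a' n = a n" if "\<bar>n\<bar> \<le> int N" for n using that p(2) by (simp add: a'_def)
    show "a' n = 0" if "\<bar>n\<bar> > int m" for n using that p(1,3) assms(1) by (simp add: a'_def)
    show "norm (a' n) \<le> weight n" for n
    proof (cases "\<bar>n\<bar> \<le> int N")
      case True
      thus ?thesis using p(2) assms(2) by (simp add: a'_def)
    next
      case False
      have "norm (p n) \<le> \<epsilon> * weight n" by (rule p(4))
      also have "\<dots> \<le> 1 * weight n" using \<epsilon> weight_pos[of n] by (intro mult_right_mono) auto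
      finally show ?thesis using False assms(1) by (simp add: a'_def)
    qed
    fix z :: complex assume z: "norm z = 1" "norm (z - centre k) \<ge> norm (1 - centre k)"
    have "trig_partial_sum a' m z = trig_partial_sum a N z + trig_partial_sum p m z"
      unfolding a'_def trig_partial_sum_add using p(1) assms(1)
      by (subst trig_partial_sum_extend[of N m]) auto
    moreover have "trig_partial_sum g M z = trig_partial_sum (rat_coeffs t) (fst t) z - trig_partial_sum a N z"
      unfolding g_def trig_partial_sum_diff
      using trig_partial_sum_extend[of N M a] trig_partial_sum_extend[of "fst t" M "rat_coeffs t"] t0 assms(1)
      by (simp add: M_def)
    ultimately have "trig_partial_sum a' m z - trig_partial_sum (rat_coeffs t) (fst t) z =
        trig_partial_sum p m z - trig_partial_sum g M z" by simp
    thus "norm (trig_partial_sum a' m z - trig_partial_sum (rat_coeffs t) (fst t) z) \<le> 1 / real (k + 1)"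
      using p(5)[OF z] by (simp only: \<epsilon>_def)
  qed (rule p(1))
qed

lemma universal_series_exists:
  obtains a :: "int \<Rightarrow> complex" and N :: "nat \<Rightarrow> nat" where
    "\<And>n. norm (a n) \<le> weight n" "strict_mono N" "\<And>k. N k > 0"
    "\<And>k z. norm z = 1 \<Longrightarrow> norm (z - centre k) \<ge> norm (1 - centre k) \<Longrightarrow>
      norm (trig_partial_sum a (N k) z - trig_partial_sum (rat_coeffs (target k)) (fst (target k)) z) \<le> 1 / real (k + 1)"
proof -
  define Q :: "nat \<Rightarrow> (int \<Rightarrow> complex) \<times> nat \<Rightarrow> bool" where
    "Q = (\<lambda>_ (a, N). (\<forall>n. \<bar>n\<bar> > int N \<longrightarrow> a n = 0) \<and> (\<forall>n. norm (a n) \<le> weight n))"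
  define R :: "nat \<Rightarrow> (int \<Rightarrow> complex) \<times> nat \<Rightarrow> (int \<Rightarrow> complex) \<times> nat \<Rightarrow> bool" where
    "R = (\<lambda>k (a, N) (a', N'). N' > N \<and> (\<forall>n. \<bar>n\<bar> \<le> int N \<longrightarrow> a' n = a n) \<and>
      (\<forall>z. norm z = 1 \<longrightarrow> norm (z - centre k) \<ge> norm (1 - centre k) \<longrightarrow>
      norm (trig_partial_sum a' N' z - trig_partial_sum (rat_coeffs (target k)) (fst (target k)) z) \<le> 1 / real (k + 1)))"
  have "\<exists>s. \<forall>k. Q k (s k) \<and> R k (s k) (s (Suc k))"
  proof (rule dependent_nat_choice)
    show "\<exists>x. Q 0 x"
      by (rule exI[of _ "(\<lambda>_. 0, 0)"]) (auto simp: Q_def less_imp_le[OF weight_pos])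
    fix x k assume x: "Q k x"
    obtain a N where [simp]: "x = (a, N)" by (cases x)
    have "\<exists>a' N'. N' > N \<and> (\<forall>n. \<bar>n\<bar> \<le> int N \<longrightarrow> a' n = a n) \<and> (\<forall>n. \<bar>n\<bar> > int N' \<longrightarrow> a' n = 0) \<and>
    (\<forall>n. norm (a' n) \<le> weight n) \<and>
    (\<forall>z. norm z = 1 \<longrightarrow> norm (z - centre k) \<ge> norm (1 - centre k) \<longrightarrow>
      norm (trig_partial_sum a' N' z - trig_partial_sum (rat_coeffs (target k)) (fst (target k)) z) \<le> 1 / real (k + 1))"
      using x by (intro universal_series_stage) (auto simp: Q_def)
    then obtain a' N' where "N' > N \<and> (\<forall>n. \<bar>n\<bar> \<le> int N \<longrightarrow> a' n = a n) \<and> (\<forall>n. \<bar>n\<bar> > int N' \<longrightarrow> a' n = 0) \<and>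
    (\<forall>n. norm (a' n) \<le> weight n) \<and>
    (\<forall>z. norm z = 1 \<longrightarrow> norm (z - centre k) \<ge> norm (1 - centre k) \<longrightarrow>
      norm (trig_partial_sum a' N' z - trig_partial_sum (rat_coeffs (target k)) (fst (target k)) z) \<le> 1 / real (k + 1))"
      by (elim exE) (rule that)
    thus "\<exists>y. Q (Suc k) y \<and> R k x y"
      by (intro exI[of _ "(a', N')"]) (auto simp: Q_def R_def)
  qed
  then obtain s where "\<forall>k. Q k (s k) \<and> R k (s k) (s (Suc k))" by (rule exE)
  hence s: "\<And>k. Q k (s k)" "\<And>k. R k (s k) (s (Suc k))" by simp_all
  define b where "b = (\<lambda>k. fst (s k))"
  define M where "M = (\<lambda>k. snd (s k))"
  have bM: "norm (b k n) \<le> weight n" "M k < M (Suc k)" "\<bar>n\<bar> \<le> int (M k) \<Longrightarrow> b (Suc k) n = b k n"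
    "norm z = 1 \<Longrightarrow> norm (z - centre k) \<ge> norm (1 - centre k) \<Longrightarrow>
      norm (trig_partial_sum (b (Suc k)) (M (Suc k)) z - trig_partial_sum (rat_coeffs (target k)) (fst (target k)) z) \<le> 1 / real (k + 1)"
    for k n z
    using s(1)[of k] s(2)[of k] by (auto simp: Q_def R_def b_def M_def case_prod_unfold)
  have M: "strict_mono M" using bM(2) by (simp add: strict_mono_Suc_iff)
  have stable: "b l n = b k n" if "k \<le> l" "\<bar>n\<bar> \<le> int (M k)" for k l n
    using that(1)
  proof (induction l rule: dec_induct)
    case (step l)
    have "M k \<le> M l" using M step(1) by (simp add: strict_mono_less_eq)
    thus ?case using bM(3)[of n l] step that(2) by simp
  qed auto
  \<comment> \<open>The orders increase strictly, so \<open>|n| \<le> M |n|\<close>: the coefficient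
    of \<open>n\<close> is final from state \<open>|n|\<close> on.\<close>
  define a where "a = (\<lambda>n. b (nat \<bar>n\<bar>) n)"
  have a_eq: "a n = b k n" if "\<bar>n\<bar> \<le> int (M k)" for n k
  proof -
    have "\<bar>n\<bar> \<le> int (M (nat \<bar>n\<bar>))" using strict_mono_imp_increasing[OF M, of "nat \<bar>n\<bar>"] by linarith
    thus ?thesis unfolding a_def using stable[of k "nat \<bar>n\<bar>" n] stable[of "nat \<bar>n\<bar>" k n] that
      by (metis nle_le)
  qed
  show ?thesis
  \<comment> \<open>The k-th correction is complete in state \<open>k + 1\<close>; the shift also
    makes all orders positive.\<close>
  proof (rule that[of a "\<lambda>k. M (Suc k)"])
    show "norm (a n) \<le> weight n" for n by (simp add: a_def bM)
    show "strict_mono (\<lambda>k. M (Suc k))" using bM(2) by (simp add: strict_mono_Suc_iff)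
    show "M (Suc k) > 0" for k using bM(2)[of k] by linarith
    fix k and z :: complex assume "norm z = 1" "norm (z - centre k) \<ge> norm (1 - centre k)"
    moreover have "trig_partial_sum a (M (Suc k)) z = trig_partial_sum (b (Suc k)) (M (Suc k)) z"
      by (intro trig_partial_sum_cong a_eq)
    ultimately show "norm (trig_partial_sum a (M (Suc k)) z -
        trig_partial_sum (rat_coeffs (target k)) (fst (target k)) z) \<le> 1 / real (k + 1)"
      using bM(4) by simp
  qed
qed

text \<open>Dropping the shift by 3 enlarges the exponent once the logarithm is positive, hence the
  threshold 2.\<close>

lemma weight_bigo:
  "weight \<in> O[int_abs_at_top](\<lambda>n. exp (real_of_int \<bar>n\<bar> * ln (real_of_int \<bar>n\<bar>) powr (-1)))"
proof (rule bigoI[of _ 1])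
  have "eventually (\<lambda>m::int. m \<ge> 2) at_top" by (rule eventually_ge_at_top)
  hence "eventually (\<lambda>n::int. \<bar>n\<bar> \<ge> 2) int_abs_at_top"
    unfolding int_abs_at_top_def by (rule eventually_filtercomapI)
  thus "eventually (\<lambda>n. norm (weight n) \<le> 1 * norm (exp (real_of_int \<bar>n\<bar> * ln (real_of_int \<bar>n\<bar>) powr (-1)))) int_abs_at_top"
  proof eventually_elim
    case (elim n)
    define t where "t = real_of_int \<bar>n\<bar>"
    have t: "t \<ge> 2" using elim by (simp add: t_def)
    have l: "ln t > 0" using t by simp
    have "ln (t + 3) \<ge> ln t" using t by simp
    hence "t / ln (t + 3) \<le> t / ln t" using t l by (intro divide_left_mono mult_pos_pos) linarith+
    also have "\<dots> = t * ln t powr (-1)" using l by (simp add: powr_minus_divide)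
    finally show ?case by (simp add: weight_def t_def)
  qed
qed

text \<open>Along \<open>\<kappa>\<close> the targets tend to \<open>f\<close> uniformly, and at a
  fixed \<open>z\<close> the partial sums follow them as soon as \<open>z\<close> stays outside the
  exceptional balls.\<close>

lemma pointwise_universal_exists:
  obtains a where "pointwise_universal a" "\<And>n. norm (a n) \<le> weight n"
proof -
  obtain a N where aN: "\<And>n. norm (a n) \<le> weight n" "strict_mono N" "\<And>k. N k > 0"
    "\<And>k z. norm z = 1 \<Longrightarrow> norm (z - centre k) \<ge> norm (1 - centre k) \<Longrightarrow>
      norm (trig_partial_sum a (N k) z - trig_partial_sum (rat_coeffs (target k)) (fst (target k)) z) \<le> 1 / real (k + 1)"
    using universal_series_exists by metis
  have "pointwise_universal a"
    unfolding pointwise_universal_def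
  proof (intro allI impI)
    fix f :: "complex \<Rightarrow> complex" assume f: "continuous_on (sphere 0 1) f"
    define good where "good = (\<lambda>i k. \<forall>z\<in>sphere 0 1.
      norm (trig_partial_sum (rat_coeffs (target k)) (fst (target k)) z - f z) \<le> 1 / real (i + 1))"
    have ex: "\<exists>k>K. good i k" for i K
    proof -
      obtain r xs where "\<forall>z\<in>sphere 0 1. norm (trig_partial_sum (rat_coeffs (r, xs)) r z - f z) \<le> 1 / real (i + 1)"
        using rat_trig_poly_dense[OF f, of "1 / real (i + 1)"] by auto
      moreover obtain k where "k > K" "target k = (r, xs)" using target_infinitely_often by blast
      ultimately show ?thesis unfolding good_def by auto
    qed
    have "\<exists>\<kappa>. \<forall>i. good i (\<kappa> i) \<and> \<kappa> i < \<kappa> (Suc i)"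
      by (rule dependent_nat_choice) (use ex in blast)+
    then obtain \<kappa> where \<kappa>: "\<And>i. good i (\<kappa> i)" "\<And>i. \<kappa> i < \<kappa> (Suc i)" by blast
    have \<kappa>_mono: "strict_mono \<kappa>" using \<kappa>(2) by (simp add: strict_mono_Suc_iff)
    show "\<exists>n. strict_mono n \<and> (\<forall>k. n k > 0) \<and> (\<forall>z\<in>sphere 0 1. (\<lambda>k. trig_partial_sum a (n k) z) \<longlonglongrightarrow> f z)"
    proof (intro exI conjI ballI allI)
      show "strict_mono (\<lambda>i. N (\<kappa> i))" using strict_mono_o[OF aN(2) \<kappa>_mono] by (simp add: o_def)
      show "N (\<kappa> k) > 0" for k by (rule aN(3))
      fix z :: complex assume z: "z \<in> sphere 0 1"
      have "eventually (\<lambda>i. norm (z - centre (\<kappa> i)) \<ge> norm (1 - centre (\<kappa> i))) sequentially"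
        using eventually_outside_ball filterlim_subseq[OF \<kappa>_mono] by (rule eventually_compose_filterlim)
      hence "eventually (\<lambda>i. norm (trig_partial_sum a (N (\<kappa> i)) z - f z) \<le> 2 / real (i + 1)) sequentially"
      proof eventually_elim
        case (elim i)
        let ?g = "trig_partial_sum (rat_coeffs (target (\<kappa> i))) (fst (target (\<kappa> i))) z"
        have "norm (trig_partial_sum a (N (\<kappa> i)) z - ?g) \<le> 1 / real (\<kappa> i + 1)"
          using elim z by (intro aN(4)) auto
        also have "\<dots> \<le> 1 / real (i + 1)"
          using strict_mono_imp_increasing[OF \<kappa>_mono, of i] by (intro divide_left_mono) auto
        finally have 1: "norm (trig_partial_sum a (N (\<kappa> i)) z - ?g) \<le> 1 / real (i + 1)" .
        have 2: "norm (?g - f z) \<le> 1 / real (i + 1)" using \<kappa>(1)[of i] z by (auto simp: good_def)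
        show ?case using norm_triangle_mono[OF 1 2] by simp
      qed
      moreover have "(\<lambda>i. 2 / real (i + 1)) \<longlonglongrightarrow> 0" by real_asymp
      ultimately have "(\<lambda>i. trig_partial_sum a (N (\<kappa> i)) z - f z) \<longlonglongrightarrow> 0"
        by (rule Lim_null_comparison)
      thus "(\<lambda>i. trig_partial_sum a (N (\<kappa> i)) z) \<longlonglongrightarrow> f z" by (simp add: LIM_zero_iff)
    qed
  qed
  thus ?thesis using aN(1) that by blast
qed

subsection \<open>Averaging and non-quasianalytic growth\<close>

text \<open>The Fourier multiplier of averaging over an interval of half-length
  \<open>d\<close>.\<close>

definition sinc_coeff :: "real \<Rightarrow> int \<Rightarrow> real" where
  "sinc_coeff d j = (if j = 0 then 1 else sin (real_of_int j * d) / (real_of_int j * d))"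

lemma sinc_coeff_0 [simp]: "sinc_coeff d 0 = 1"
  by (simp add: sinc_coeff_def)

lemma abs_sinc_coeff_le_1: "\<bar>sinc_coeff d j\<bar> \<le> 1"
proof (cases "real_of_int j * d = 0")
  case False
  thus ?thesis using abs_sin_x_le_abs_x[of "real_of_int j * d"]
    by (auto simp: sinc_coeff_def divide_le_eq_1 simp flip: abs_mult)
qed (auto simp: sinc_coeff_def)

lemma abs_sinc_coeff_le: "\<bar>sinc_coeff d j\<bar> \<le> 1 / (real_of_int \<bar>j\<bar> * d)" if "j \<noteq> 0" "d > 0"
  using that by (auto simp: sinc_coeff_def abs_mult intro!: divide_right_mono)

abbreviation trig_fun :: "(int \<Rightarrow> complex) \<Rightarrow> nat \<Rightarrow> real \<Rightarrow> complex" where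
  "trig_fun b n x \<equiv> trig_partial_sum b n (cis x)"

lemma trig_fun_altdef: "trig_fun b n x = (\<Sum>j\<in>{- int n..int n}. b j * cis (real_of_int j * x))"
  by (simp add: trig_partial_sum_def cis_power_int)

lemma continuous_on_trig_fun: "continuous_on S (trig_fun b n)"
  unfolding trig_fun_altdef unfolding cis_conv_exp by (intro continuous_intros)

lemma has_integral_cis:
  assumes "d > 0"
  shows "((\<lambda>t. cis (real_of_int j * t)) has_integral
    (of_real (2 * d * sinc_coeff d j) * cis (real_of_int j * x))) {x - d..x + d}"
proof (cases "j = 0")
  case True
  thus ?thesis using has_integral_const_real[of "1 :: complex" "x - d" "x + d"] assms
    by (simp add: scaleR_conv_of_real)
next
  case False
  define F where "F = (\<lambda>t. cis (real_of_int j * t) / (\<i> * of_int j))"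
  have "((\<lambda>t. cis (real_of_int j * t)) has_integral (F (x + d) - F (x - d))) {x - d..x + d}"
  proof (rule fundamental_theorem_of_calculus)
    fix t
    have "((\<lambda>z. exp (\<i> * of_int j * z) / (\<i> * of_int j)) has_field_derivative
        exp (\<i> * of_int j * of_real t)) (at (of_real t))"
      using False by (auto intro!: derivative_eq_intros)
    from has_vector_derivative_real_field[OF this]
    show "(F has_vector_derivative cis (real_of_int j * t)) (at t within {x - d..x + d})"
      by (simp add: F_def cis_conv_exp mult_ac)
  qed (use assms in auto)
  moreover have "F (x + d) - F (x - d) = of_real (2 * d * sinc_coeff d j) * cis (real_of_int j * x)"
  proof -
    have "cis (real_of_int j * (x + d)) - cis (real_of_int j * (x - d)) =
        cis (real_of_int j * x) * (cis (real_of_int j * d) - cis (- (real_of_int j * d)))"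
      by (simp add: cis_mult algebra_simps)
    also have "cis (real_of_int j * d) - cis (- (real_of_int j * d)) = 2 * \<i> * of_real (sin (real_of_int j * d))"
      by (simp add: complex_eq_iff)
    finally show ?thesis using False assms
      by (simp add: F_def sinc_coeff_def field_simps flip: diff_divide_distrib)
  qed
  ultimately show ?thesis by simp
qed

lemma trig_fun_average:
  assumes "d > 0"
  shows "(trig_fun b n has_integral
    (of_real (2 * d) * trig_fun (\<lambda>j. b j * of_real (sinc_coeff d j)) n x)) {x - d..x + d}"
proof -
  have "((\<lambda>t. \<Sum>j\<in>{- int n..int n}. b j * cis (real_of_int j * t)) has_integral
    (\<Sum>j\<in>{- int n..int n}. b j * (of_real (2 * d * sinc_coeff d j) * cis (real_of_int j * x)))) {x - d..x + d}"
    by (intro has_integral_sum has_integral_mult_right has_integral_cis assms) auto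
  moreover have "(\<Sum>j\<in>{- int n..int n}. b j * (of_real (2 * d * sinc_coeff d j) * cis (real_of_int j * x))) =
      of_real (2 * d) * (\<Sum>j\<in>{- int n..int n}. b j * of_real (sinc_coeff d j) * cis (real_of_int j * x))"
    by (simp add: sum_distrib_left mult_ac)
  ultimately show ?thesis unfolding trig_fun_altdef by simp
qed

text \<open>One average turns an integral bound into a pointwise bound; this is how dominated
  convergence enters.\<close>

lemma norm_average_le_integral:
  assumes d: "d > 0" and "{x - d..x + d} \<subseteq> {u..v}"
    and I: "integral {u..v} (\<lambda>t. norm (trig_fun b n t)) \<le> 2 * d * \<beta>"
  shows "norm (trig_fun (\<lambda>j. b j * of_real (sinc_coeff d j)) n x) \<le> \<beta>"
proof -
  have int: "(\<lambda>t. norm (trig_fun b n t)) integrable_on {p..q}" for p q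
    by (intro integrable_continuous_real continuous_on_norm continuous_on_trig_fun)
  have "2 * d * norm (trig_fun (\<lambda>j. b j * of_real (sinc_coeff d j)) n x) =
      norm (integral {x - d..x + d} (trig_fun b n))"
    using d by (simp add: integral_unique[OF trig_fun_average[OF d]] norm_mult)
  also have "\<dots> \<le> integral {x - d..x + d} (\<lambda>t. norm (trig_fun b n t))"
    by (intro integral_norm_bound_integral int integrable_continuous_real continuous_on_trig_fun) auto
  also have "\<dots> \<le> integral {u..v} (\<lambda>t. norm (trig_fun b n t))"
    by (intro integral_subset_le assms int) auto
  finally have "2 * d * norm (trig_fun (\<lambda>j. b j * of_real (sinc_coeff d j)) n x) \<le> 2 * d * \<beta>"
    using I by linarith
  thus ?thesis using d by (subst (asm) mult_le_cancel_left_pos) auto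
qed

lemma norm_average_le:
  assumes d: "d > 0" and b: "\<And>t. \<bar>t - y\<bar> \<le> r \<Longrightarrow> norm (trig_fun b n t) \<le> B"
    and x: "\<bar>x - y\<bar> \<le> r - d"
  shows "norm (trig_fun (\<lambda>j. b j * of_real (sinc_coeff d j)) n x) \<le> B"
proof (rule norm_average_le_integral[OF d order_refl])
  have "integral {x - d..x + d} (\<lambda>t. norm (trig_fun b n t)) \<le> integral {x - d..x + d} (\<lambda>t. B)"
    using x by (intro integral_le integrable_continuous_real continuous_on_norm
      continuous_on_trig_fun continuous_on_const b) auto
  thus "integral {x - d..x + d} (\<lambda>t. norm (trig_fun b n t)) \<le> 2 * d * B"
    using d by simp
qed

lemma norm_average_power_le:
  assumes d: "d > 0" and b: "\<And>t. \<bar>t - y\<bar> \<le> r \<Longrightarrow> norm (trig_fun b n t) \<le> B"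
    and x: "\<bar>x - y\<bar> \<le> r - real m * d"
  shows "norm (trig_fun (\<lambda>j. b j * of_real (sinc_coeff d j ^ m)) n x) \<le> B"
  using x
proof (induction m arbitrary: x)
  case 0
  thus ?case using b by simp
next
  case (Suc m x)
  have "norm (trig_fun (\<lambda>j. b j * of_real (sinc_coeff d j ^ m) * of_real (sinc_coeff d j)) n x) \<le> B"
  proof (rule norm_average_le[where y = y and r = "r - real m * d"])
    show "norm (trig_fun (\<lambda>j. b j * of_real (sinc_coeff d j ^ m)) n t) \<le> B"
      if "\<bar>t - y\<bar> \<le> r - real m * d" for t
      using that by (rule Suc.IH)
  qed (use d Suc.prems in \<open>auto simp: algebra_simps\<close>)
  thus ?case by (simp add: mult_ac)
qed

text \<open>An average at a point sees only points within the half-length, so each averaging shrinks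
  the controlled interval by that amount. Summable widths keep the total loss small.\<close>

lemma norm_average_prod_le:
  fixes \<eta> :: "nat \<Rightarrow> real"
  assumes d: "\<And>i. \<eta> i > 0" and b: "\<And>t. \<bar>t - y\<bar> \<le> r \<Longrightarrow> norm (trig_fun b n t) \<le> B"
    and x: "\<bar>x - y\<bar> \<le> r - (\<Sum>i<K. real (m i) * \<eta> i)"
  shows "norm (trig_fun (\<lambda>j. b j * of_real (\<Prod>i<K. sinc_coeff (\<eta> i) j ^ m i)) n x) \<le> B"
  using x
proof (induction K arbitrary: x)
  case 0
  thus ?case using b by simp
next
  case (Suc K x)
  have "norm (trig_fun (\<lambda>j. b j * of_real (\<Prod>i<K. sinc_coeff (\<eta> i) j ^ m i) * of_real (sinc_coeff (\<eta> K) j ^ m K)) n x) \<le> B"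
  proof (rule norm_average_power_le[where y = y and r = "r - (\<Sum>i<K. real (m i) * \<eta> i)"])
    show "norm (trig_fun (\<lambda>j. b j * of_real (\<Prod>i<K. sinc_coeff (\<eta> i) j ^ m i)) n t) \<le> B"
      if "\<bar>t - y\<bar> \<le> r - (\<Sum>i<K. real (m i) * \<eta> i)" for t
      using that by (rule Suc.IH)
  qed (use d Suc.prems in \<open>auto simp: algebra_simps\<close>)
  thus ?case by (simp add: mult_ac)
qed

text \<open>The widths are \<open>\<eta> i = c * 2 ^ (- i) * (i + 1) powr (- 1 - \<epsilon> / 3)\<close>, used \<open>2 ^ i\<close> times each. At frequency
  \<open>j\<close> the single block with \<open>2 ^ i\<close> comparable to \<open>\<bar>j\<bar> / ln \<bar>j\<bar> powr (1 + 2 * \<epsilon> / 3)\<close> already gives the decay.\<close>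
lemma nonquasianalytic_multipliers:
  fixes \<epsilon> \<rho> :: real
  assumes "\<epsilon> > 0" "\<rho> > 0"
  obtains \<eta> :: "nat \<Rightarrow> real" and N :: nat where
    "\<And>i. \<eta> i > 0" "\<And>K. (\<Sum>i<K. real (2 ^ i) * \<eta> i) \<le> \<rho>"
    "\<And>(j::int) K. \<bar>j\<bar> \<ge> int N \<Longrightarrow> int K > \<bar>j\<bar> \<Longrightarrow>
      exp (real_of_int \<bar>j\<bar> * ln (real_of_int \<bar>j\<bar>) powr (-1 - \<epsilon>)) * (\<Prod>i<K. \<bar>sinc_coeff (\<eta> i) j\<bar> ^ (2 ^ i)) \<le> 1 / (real_of_int \<bar>j\<bar>)\<^sup>2"
proof -
  \<comment> \<open>The powers of the logarithm are spaced by \<open>s\<close>: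
    \<open>-1 - s\<close> for the widths, \<open>-1 - 2 * s\<close> for the size of the chosen
    block, \<open>-1 - 3 * s\<close> for the growth of the coefficients.\<close>
  define s where "s = \<epsilon> / 3"
  have s: "s > 0" "\<epsilon> = 3 * s" using assms by (auto simp: s_def)
  define z where "z = (\<lambda>i::nat. real (Suc i) powr (- 1 - s))"
  have "summable (\<lambda>i. real i powr (-1 - s))" using s by (subst summable_real_powr_iff) auto
  hence z: "summable z" unfolding z_def by (subst summable_Suc_iff)
  have z_pos: "z i > 0" for i by (simp add: z_def)
  define c where "c = \<rho> / suminf z"
  have Z: "suminf z > 0" by (rule suminf_pos[OF z z_pos])
  have c: "c > 0" using assms Z by (simp add: c_def)
  define \<eta> where "\<eta> = (\<lambda>i. c * z i / 2 ^ i)"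
  have \<eta>_pos: "\<eta> i > 0" for i using c z_pos by (simp add: \<eta>_def)
  have sum_le: "(\<Sum>i<K. real (2 ^ i) * \<eta> i) \<le> \<rho>" for K
  proof -
    have "(\<Sum>i<K. real (2 ^ i) * \<eta> i) = c * (\<Sum>i<K. z i)"
      by (simp add: \<eta>_def sum_distrib_left)
    also have "\<dots> \<le> c * suminf z"
      using c z z_pos by (intro mult_left_mono sum_le_suminf) (auto intro: less_imp_le)
    also have "\<dots> = \<rho>" using Z by (simp add: c_def)
    finally show ?thesis .
  qed
  \<comment> \<open>This condition will give \<open>t * \<eta> i \<ge> exp 1\<close> for the chosen
    block; the last one says that the decay \<open>exp (- X / 2)\<close> beats the growth with a
    margin \<open>1 / t\<^sup>2\<close>.\<close>
  have "eventually (\<lambda>t::real. c * 3 powr (-1 - s) * ln t powr s \<ge> exp 1) at_top"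
    using s c by real_asymp
  moreover have "eventually (\<lambda>t::real. t * ln t powr (-1 - 2 * s) \<ge> 1) at_top"
    using s by real_asymp
  moreover have "eventually (\<lambda>t::real. ln t \<ge> 1) at_top" by real_asymp
  moreover have "eventually (\<lambda>t::real. exp (t * ln t powr (-1 - 3 * s) - t * ln t powr (-1 - 2 * s) / 2) \<le> 1 / t\<^sup>2) at_top"
    using s by real_asymp
  ultimately have "eventually (\<lambda>t::real. c * 3 powr (-1 - s) * ln t powr s \<ge> exp 1 \<and>
      t * ln t powr (-1 - 2 * s) \<ge> 1 \<and> ln t \<ge> 1 \<and>
      exp (t * ln t powr (-1 - 3 * s) - t * ln t powr (-1 - 2 * s) / 2) \<le> 1 / t\<^sup>2) at_top"
    by eventually_elim blast
  then obtain T where T: "\<And>t. t \<ge> T \<Longrightarrow> c * 3 powr (-1 - s) * ln t powr s \<ge> exp 1 \<and>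
      t * ln t powr (-1 - 2 * s) \<ge> 1 \<and> ln t \<ge> 1 \<and>
      exp (t * ln t powr (-1 - 3 * s) - t * ln t powr (-1 - 2 * s) / 2) \<le> 1 / t\<^sup>2"
    unfolding eventually_at_top_linorder by blast
  define N where "N = nat \<lceil>T\<rceil> + 1"
  show ?thesis
  proof (rule that[of \<eta> N])
    fix j :: int and K :: nat
    assume j: "\<bar>j\<bar> \<ge> int N" and K: "int K > \<bar>j\<bar>"
    define t where "t = real_of_int \<bar>j\<bar>"
    have tT: "t \<ge> T" and t1: "t \<ge> 1" using j unfolding t_def N_def by linarith+
    note T = T[OF tT]
    define X where "X = t * ln t powr (-1 - 2 * s)"
    have X1: "X \<ge> 1" using T by (simp add: X_def)
    have l: "ln t \<ge> 1" using T by simp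
    have "ln t powr (-1 - 2 * s) \<le> ln t powr 0" using l s by (intro powr_mono) auto
    hence "ln t powr (-1 - 2 * s) \<le> 1" using l by simp
    hence Xt: "X \<le> t * 1" unfolding X_def using t1 by (intro mult_left_mono) auto
    define i where "i = nat \<lfloor>log 2 X\<rfloor>"
    have iX: "real i \<le> log 2 X" "log 2 X < real i + 1"
      using X1 unfolding i_def by (auto simp: of_nat_nat)
    have i1: "2 ^ i \<le> X"
      using iX(1) X1 by (simp add: le_log_iff powr_realpow)
    have i2: "X < 2 * 2 ^ i"
    proof -
      have "X < 2 powr (real i + 1)" using iX(2) X1 by (simp add: log_less_iff)
      thus ?thesis by (simp add: powr_add powr_realpow)
    qed
    \<comment> \<open>From \<open>i < 2 ^ i \<le> X \<le> t < K\<close>, the chosen block is among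
      the first \<open>K\<close>.\<close>
    have iK: "i < K"
    proof -
      have "real i < 2 ^ i" by (rule of_nat_less_two_power)
      hence "real i < t" using i1 Xt by linarith
      thus ?thesis using K unfolding t_def by linarith
    qed
    have i3: "real (Suc i) \<le> 3 * ln t"
    proof -
      have "log 2 X \<le> log 2 t" using X1 Xt by simp
      also have "\<dots> = ln t / ln 2" by (simp add: log_def)
      also have "\<dots> \<le> ln t * 2"
        using l ln2_ge_two_thirds by (simp add: field_simps)
      finally show ?thesis using iX(1) l by simp
    qed
    have z_ge: "z i \<ge> 3 powr (-1 - s) * ln t powr (-1 - s)"
    proof -
      have "(3 * ln t) powr (-1 - s) \<le> z i"
        unfolding z_def using i3 s by (intro powr_mono2') auto
      thus ?thesis using l by (simp add: powr_mult)
    qed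
    have "exp 1 \<le> c * 3 powr (-1 - s) * ln t powr s" using T by simp
    \<comment> \<open>The quotient \<open>t / X\<close> supplies the power \<open>1 + 2 * s\<close>
      and the width the power \<open>-1 - s\<close>; the surplus \<open>s\<close> outgrows the
      constants.\<close>
    also have "ln t powr s = ln t powr (1 + 2 * s) * ln t powr (-1 - s)"
      by (simp flip: powr_add)
    also have "c * 3 powr (-1 - s) * (ln t powr (1 + 2 * s) * ln t powr (-1 - s)) =
        c * (3 powr (-1 - s) * ln t powr (-1 - s)) * ln t powr (1 + 2 * s)" by simp
    also have "\<dots> \<le> c * z i * ln t powr (1 + 2 * s)"
      using z_ge c by (intro mult_right_mono mult_left_mono) auto
    also have "ln t powr (1 + 2 * s) = t / X"
    proof -
      have "ln t powr (-1 - 2 * s) * ln t powr (1 + 2 * s) = 1"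
        using l by (simp flip: powr_add)
      hence "ln t powr (1 + 2 * s) = 1 / ln t powr (-1 - 2 * s)"
        using l by (subst eq_divide_eq) (auto simp: mult.commute)
      thus ?thesis using t1 by (simp add: X_def)
    qed
    also have "c * z i * (t / X) \<le> c * z i * (t / 2 ^ i)"
      using i1 t1 X1 c z_pos[of i] by (intro mult_left_mono divide_left_mono) auto
    also have "\<dots> = t * \<eta> i" by (simp add: \<eta>_def)
    finally have e: "exp 1 \<le> t * \<eta> i" .
    have "\<bar>sinc_coeff (\<eta> i) j\<bar> \<le> 1 / (t * \<eta> i)"
      using abs_sinc_coeff_le[of j "\<eta> i"] \<eta>_pos[of i] t1 by (auto simp: t_def)
    also have "\<dots> \<le> 1 / exp 1" using e t1 \<eta>_pos[of i] by (intro divide_left_mono) auto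
    finally have "\<bar>sinc_coeff (\<eta> i) j\<bar> ^ (2 ^ i) \<le> (1 / exp 1) ^ (2 ^ i)"
      by (intro power_mono) auto
    also have "\<dots> = exp (- real (2 ^ i))"
      by (simp add: exp_minus power_divide exp_of_nat_mult[symmetric] field_simps)
    also have "\<dots> \<le> exp (- X / 2)" using i2 by simp
    finally have main: "\<bar>sinc_coeff (\<eta> i) j\<bar> ^ (2 ^ i) \<le> exp (- X / 2)" .
    \<comment> \<open>All other blocks are merely bounded by 1.\<close>
    have "(\<Prod>i<K. \<bar>sinc_coeff (\<eta> i) j\<bar> ^ (2 ^ i)) =
        \<bar>sinc_coeff (\<eta> i) j\<bar> ^ (2 ^ i) * (\<Prod>i\<in>{..<K} - {i}. \<bar>sinc_coeff (\<eta> i) j\<bar> ^ (2 ^ i))"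
      using iK by (subst prod.remove[of _ i]) auto
    also have "\<dots> \<le> exp (- X / 2) * 1"
      by (intro mult_mono main prod_le_1 prod_nonneg conjI power_le_one abs_sinc_coeff_le_1) auto
    finally have P: "(\<Prod>i<K. \<bar>sinc_coeff (\<eta> i) j\<bar> ^ (2 ^ i)) \<le> exp (- X / 2)" by simp
    have "exp (t * ln t powr (-1 - \<epsilon>)) * (\<Prod>i<K. \<bar>sinc_coeff (\<eta> i) j\<bar> ^ (2 ^ i)) \<le>
        exp (t * ln t powr (-1 - 3 * s)) * exp (- X / 2)"
      unfolding s(2) by (intro mult_left_mono P) auto
    also have "\<dots> = exp (t * ln t powr (-1 - 3 * s) - t * ln t powr (-1 - 2 * s) / 2)"
      by (simp add: X_def flip: exp_add)
    also have "\<dots> \<le> 1 / t\<^sup>2" using T by simp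
    finally show "exp (real_of_int \<bar>j\<bar> * ln (real_of_int \<bar>j\<bar>) powr (-1 - \<epsilon>)) *
        (\<Prod>i<K. \<bar>sinc_coeff (\<eta> i) j\<bar> ^ (2 ^ i)) \<le> 1 / (real_of_int \<bar>j\<bar>)\<^sup>2"
      by (simp add: t_def)
  qed (rule \<eta>_pos, rule sum_le)
qed

section \<open>Tail estimates and the contradiction\<close>

lemma trig_partial_sum_Suc:
  "trig_partial_sum b (Suc m) z =
     trig_partial_sum b m z + b (int (Suc m)) * z powi (int (Suc m)) + b (- int (Suc m)) * z powi (- int (Suc m))"
proof -
  have "{- int (Suc m)..int (Suc m)} = insert (int (Suc m)) (insert (- int (Suc m)) {- int m..int m})"
    by auto
  thus ?thesis unfolding trig_partial_sum_def by (simp only:) (simp add: add_ac)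
qed

text \<open>The tail telescopes by \<open>1 / (m + 1)\<^sup>2 \<le> 1 / m - 1 / (m + 1)\<close>,
  twice because of the two signs. The coefficient bound is asked up to \<open>m\<close> only, since
  a product of \<open>K\<close> multiplier blocks is controlled only for
  \<open>|j| < K\<close>.\<close>

lemma norm_trig_partial_sum_tail_le:
  assumes "norm z = 1" "1 \<le> n" "n \<le> m"
    and b: "\<And>j. \<bar>j\<bar> > int n \<Longrightarrow> \<bar>j\<bar> \<le> int m \<Longrightarrow> norm (b j) \<le> C / (real_of_int \<bar>j\<bar>)\<^sup>2"
    and "C \<ge> 0"
  shows "norm (trig_partial_sum b m z - trig_partial_sum b n z) \<le> 2 * C * (1 / real n - 1 / real m)"
  using assms(3) b
proof (induction m rule: dec_induct)
  case base
  show ?case by simp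
next
  case (step m)
  let ?M = "int (Suc m)"
  have 1: "norm (trig_partial_sum b m z - trig_partial_sum b n z) \<le> 2 * C * (1 / real n - 1 / real m)"
    by (rule step.IH) (use step.prems in auto)
  have 2: "norm (b ?M * z powi ?M) \<le> C / (real (Suc m))\<^sup>2" "norm (b (- ?M) * z powi (- ?M)) \<le> C / (real (Suc m))\<^sup>2"
    using step.prems[of ?M] step.prems[of "- ?M"] step.hyps assms(1)
    by (simp_all add: norm_mult norm_power_int add_ac)
  have "trig_partial_sum b (Suc m) z - trig_partial_sum b n z =
      (trig_partial_sum b m z - trig_partial_sum b n z) + b ?M * z powi ?M + b (- ?M) * z powi (- ?M)"
    unfolding trig_partial_sum_Suc by simp
  also have "norm \<dots> \<le> 2 * C * (1 / real n - 1 / real m) + C / (real (Suc m))\<^sup>2 + C / (real (Suc m))\<^sup>2"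
    by (intro norm_triangle_mono 1 2)
  also have "\<dots> = 2 * C * (1 / real n - 1 / real m + 1 / (real (Suc m))\<^sup>2)"
    by (simp add: algebra_simps)
  also have "\<dots> \<le> 2 * C * (1 / real n - 1 / real (Suc m))"
  proof (rule mult_left_mono)
    have "1 / (real (Suc m))\<^sup>2 \<le> 1 / (real m * real (Suc m))"
      using step.hyps assms(2) by (intro divide_left_mono) (auto simp: power2_eq_square)
    also have "\<dots> = 1 / real m - 1 / real (Suc m)"
      using step.hyps assms(2) by (simp add: field_simps)
    finally show "1 / real n - 1 / real m + 1 / (real (Suc m))\<^sup>2 \<le> 1 / real n - 1 / real (Suc m)" by simp
  qed (use assms in auto)
  finally show ?case .
qed

text \<open>Pointwise boundedness covers the interval by the closed sets \<open>E N\<close>. If none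
  contained a nondegenerate subinterval, their complements would be open and dense in it with empty
  intersection, against Baire.\<close>

lemma pointwise_convergent_bounded_subinterval:
  fixes g :: "nat \<Rightarrow> real \<Rightarrow> complex"
  assumes "u < v" and cont: "\<And>k. continuous_on UNIV (g k)"
    and conv: "\<And>x. convergent (\<lambda>k. g k x)"
  obtains u' v' B where "u \<le> u'" "u' < v'" "v' \<le> v" "\<And>k x. x \<in> {u'..v'} \<Longrightarrow> norm (g k x) \<le> B"
proof -
  define E where "E = (\<lambda>N::nat. {x. \<forall>k. norm (g k x) \<le> real N})"
  have closed_E: "closed (E N)" for N
    unfolding E_def by (intro closed_Collect_all closed_Collect_le continuous_on_norm cont continuous_on_const)
  have "\<exists>N u' v'. u \<le> u' \<and> u' < v' \<and> v' \<le> v \<and> {u'..v'} \<subseteq> E N"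
  proof (rule ccontr)
    assume contra: "\<not> ?thesis"
    have "{u..v} \<subseteq> closure (\<Inter>(range (\<lambda>N. {u..v} - E N)))"
    proof (rule Baire)
      fix T assume "T \<in> range (\<lambda>N. {u..v} - E N)"
      then obtain N where N: "T = {u..v} - E N" by blast
      have "openin (top_of_set {u..v}) ({u..v} \<inter> - E N)"
        using closed_E by (intro openin_open_Int) (simp add: open_Compl)
      moreover have "{u..v} \<inter> - E N = T" using N by blast
      moreover have "x \<in> closure T" if x: "x \<in> {u..v}" for x
      proof (rule closure_approachable[THEN iffD2], intro allI impI)
        fix e :: real assume e: "e > 0"
        define u' where "u' = max u (x - e / 2)"
        define v' where "v' = min v (x + e / 2)"
        have uv': "u \<le> u'" "u' < v'" "v' \<le> v" using x e \<open>u < v\<close> by (auto simp: u'_def v'_def)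
        hence "\<not> {u'..v'} \<subseteq> E N" using contra by blast
        then obtain y where y: "y \<in> {u'..v'}" "y \<notin> E N" by blast
        hence "y \<in> T" using uv' by (auto simp: N)
        moreover have "dist y x < e" using y e by (auto simp: u'_def v'_def dist_real_def abs_if)
        ultimately show "\<exists>y\<in>T. dist y x < e" by blast
      qed
      ultimately show "openin (top_of_set {u..v}) T \<and> {u..v} \<subseteq> closure T" by auto
    qed auto
    moreover have "\<Inter>(range (\<lambda>N. {u..v} - E N)) = {}"
    proof -
      have "\<exists>N. x \<in> E N" for x
      proof -
        have "Bseq (\<lambda>k. g k x)" using conv by (rule convergent_imp_Bseq)
        then obtain K where K: "\<And>k. norm (g k x) \<le> K" by (auto simp: Bseq_def)
        have "norm (g k x) \<le> real (nat \<lceil>K\<rceil>)" for k using K[of k] by linarith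
        thus ?thesis unfolding E_def by blast
      qed
      thus ?thesis by blast
    qed
    ultimately have "{u..v} \<subseteq> closure {}" by (simp only:)
    thus False using \<open>u < v\<close> by simp
  qed
  then obtain N u' v' where "u \<le> u'" "u' < v'" "v' \<le> v" "{u'..v'} \<subseteq> E N" by blast
  thus ?thesis by (intro that[of u' v' "real N"]) (auto simp: E_def)
qed

lemma trig_partial_sum_minus_const:
  "trig_partial_sum (\<lambda>j. a j - of_bool (j = 0) * c) n z = trig_partial_sum a n z - c"
proof -
  have "trig_partial_sum (\<lambda>j. of_bool (j = 0) * c) n z = (\<Sum>j\<in>{0}. of_bool (j = 0) * c * z powi j)"
    unfolding trig_partial_sum_def by (rule sum.mono_neutral_right) auto
  thus ?thesis by (simp add: trig_partial_sum_diff)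
qed

text \<open>Subtracting \<open>c\<close> changes the coefficient of 0 only, where every multiplier
  is 1, so it commutes with averaging. Dominated convergence makes the integral of the modulus
  small, the average of half-length \<open>r / 2\<close> turns this into a uniform bound on half the
  interval, and the remaining averages lose at most the other \<open>r / 2\<close>, whatever
  \<open>K\<close> is.\<close>

lemma averaged_limit:
  fixes \<eta> :: "nat \<Rightarrow> real" and n :: "nat \<Rightarrow> nat"
  assumes r: "r > 0" and \<eta>: "\<And>i. \<eta> i > 0" "\<And>K. (\<Sum>i<K. real (2 ^ i) * \<eta> i) \<le> r / 2"
    and bound: "\<And>k x. x \<in> {x0 - r..x0 + r} \<Longrightarrow> norm (trig_fun a (n k) x) \<le> B"
    and lim: "\<And>x. (\<lambda>k. trig_fun a (n k) x) \<longlonglongrightarrow> c"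
    and e: "e > 0"
  shows "eventually (\<lambda>k. \<forall>K. norm (trig_fun (\<lambda>j. a j * of_real (sinc_coeff (r / 2) j) *
      of_real (\<Prod>i<K. sinc_coeff (\<eta> i) j ^ (2 ^ i))) (n k) x0 - c) \<le> e) sequentially"
proof -
  define b where "b = (\<lambda>j. a j - of_bool (j = 0) * c)"
  have b: "trig_fun b m x = trig_fun a m x - c" for m x
    unfolding b_def by (rule trig_partial_sum_minus_const)
  have "(\<lambda>k. integral {x0 - r..x0 + r} (\<lambda>t. norm (trig_fun b (n k) t))) \<longlonglongrightarrow> integral {x0 - r..x0 + r} (\<lambda>t. 0)"
  proof (rule dominated_convergence(2)[where h = "\<lambda>_. B + norm c"])
    show "(\<lambda>t. norm (trig_fun b (n k) t)) integrable_on {x0 - r..x0 + r}" for k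
      by (intro integrable_continuous_real continuous_on_norm continuous_on_trig_fun)
    show "norm (norm (trig_fun b (n k) x)) \<le> B + norm c" if "x \<in> {x0 - r..x0 + r}" for k x
      unfolding b using norm_triangle_ineq4[of "trig_fun a (n k) x" c] bound[OF that, of k] by simp
    show "(\<lambda>k. norm (trig_fun b (n k) x)) \<longlonglongrightarrow> 0" for x
      unfolding b using lim[of x] by (simp add: LIM_zero tendsto_norm_zero)
  qed auto
  \<comment> \<open>The threshold \<open>r * e\<close> is the window length
    \<open>2 * (r / 2)\<close> times \<open>e\<close>.\<close>
  hence "eventually (\<lambda>k. integral {x0 - r..x0 + r} (\<lambda>t. norm (trig_fun b (n k) t)) < r * e) sequentially"
    using r e by (intro order_tendstoD(2)) auto
  thus ?thesis
  proof eventually_elim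
    case (elim k)
    have 1: "norm (trig_fun (\<lambda>j. b j * of_real (sinc_coeff (r / 2) j)) (n k) x) \<le> e"
      if "\<bar>x - x0\<bar> \<le> r / 2" for x
    proof (rule norm_average_le_integral[where u = "x0 - r" and v = "x0 + r"])
      have "x - x0 \<le> r / 2" "x0 - x \<le> r / 2" using that by linarith+
      thus "{x - r / 2..x + r / 2} \<subseteq> {x0 - r..x0 + r}" by auto
    qed (use r elim in simp_all)
    show ?case
    proof
      fix K
      have "norm (trig_fun (\<lambda>j. b j * of_real (sinc_coeff (r / 2) j) *
          of_real (\<Prod>i<K. sinc_coeff (\<eta> i) j ^ (2 ^ i))) (n k) x0) \<le> e"
        by (rule norm_average_prod_le[where y = x0 and r = "r / 2", OF \<eta>(1) 1]) (use \<eta>(2)[of K] in auto)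
      moreover have "(\<lambda>j. b j * of_real (sinc_coeff (r / 2) j) * of_real (\<Prod>i<K. sinc_coeff (\<eta> i) j ^ (2 ^ i))) =
        (\<lambda>j. a j * of_real (sinc_coeff (r / 2) j) * of_real (\<Prod>i<K. sinc_coeff (\<eta> i) j ^ (2 ^ i)) - of_bool (j = 0) * c)"
        by (auto simp: b_def fun_eq_iff)
      ultimately show "norm (trig_fun (\<lambda>j. a j * of_real (sinc_coeff (r / 2) j) *
        of_real (\<Prod>i<K. sinc_coeff (\<eta> i) j ^ (2 ^ i))) (n k) x0 - c) \<le> e"
        by (simp only: trig_partial_sum_minus_const)
    qed
  qed
qed

lemma not_pointwise_universal:
  fixes \<epsilon> :: real
  assumes \<epsilon>: "\<epsilon> > 0"
    and O: "(\<lambda>n. norm (a n)) \<in> O[int_abs_at_top](\<lambda>n. exp (real_of_int \<bar>n\<bar> * ln (real_of_int \<bar>n\<bar>) powr (-1 - \<epsilon>)))"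
  shows "\<not> pointwise_universal a"
proof
  assume univ: "pointwise_universal a"
  have seq: "\<exists>n. strict_mono n \<and> (\<forall>x. (\<lambda>k. trig_fun a (n k) x) \<longlonglongrightarrow> c)" for c :: complex
  proof -
    have "\<exists>n. strict_mono n \<and> (\<forall>k. n k > 0) \<and> (\<forall>z\<in>sphere 0 1. (\<lambda>k. trig_partial_sum a (n k) z) \<longlonglongrightarrow> (\<lambda>_. c) z)"
      using univ[unfolded pointwise_universal_def, rule_format, OF continuous_on_const] .
    thus ?thesis by (elim exE) (rule exI, auto)
  qed
  obtain n where n: "strict_mono n" "\<And>x. (\<lambda>k. trig_fun a (n k) x) \<longlonglongrightarrow> 0"
    using seq[of 0] by blast
  obtain m where m: "strict_mono m" "\<And>x. (\<lambda>k. trig_fun a (m k) x) \<longlonglongrightarrow> 1"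
    using seq[of 1] by blast
  obtain u v B where uv: "u < v" "\<And>k x. x \<in> {u..v} \<Longrightarrow> norm (trig_fun a (n k) x) \<le> B"
    using pointwise_convergent_bounded_subinterval[of 0 1 "\<lambda>k. trig_fun a (n k)"] n(2)
    by (metis continuous_on_trig_fun convergentI zero_less_one)
  \<comment> \<open>The second interval is sought inside the first, so both bounds hold on
    it.\<close>
  obtain u' v' B' where uv': "u \<le> u'" "u' < v'" "v' \<le> v" "\<And>k x. x \<in> {u'..v'} \<Longrightarrow> norm (trig_fun a (m k) x) \<le> B'"
    using pointwise_convergent_bounded_subinterval[of u v "\<lambda>k. trig_fun a (m k)"] m(2) uv(1)
    by (metis continuous_on_trig_fun convergentI)
  define x0 where "x0 = (u' + v') / 2"
  define r where "r = (v' - u') / 2"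
  have r: "r > 0" using uv' by (simp add: r_def)
  have I: "{x0 - r..x0 + r} = {u'..v'}" by (simp add: x0_def r_def field_simps)
  have "r / 2 > 0" using r by simp
  then obtain \<eta> N where \<eta>: "\<And>i. \<eta> i > 0" "\<And>K. (\<Sum>i<K. real (2 ^ i) * \<eta> i) \<le> r / 2"
    "\<And>(j::int) K. \<bar>j\<bar> \<ge> int N \<Longrightarrow> int K > \<bar>j\<bar> \<Longrightarrow>
      exp (real_of_int \<bar>j\<bar> * ln (real_of_int \<bar>j\<bar>) powr (-1 - \<epsilon>)) * (\<Prod>i<K. \<bar>sinc_coeff (\<eta> i) j\<bar> ^ (2 ^ i)) \<le> 1 / (real_of_int \<bar>j\<bar>)\<^sup>2"
    using nonquasianalytic_multipliers[OF \<epsilon>, of "r / 2"] by blast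
  obtain C where C: "C > 0" "eventually (\<lambda>n. norm (norm (a n)) \<le> C * norm (exp (real_of_int \<bar>n\<bar> * ln (real_of_int \<bar>n\<bar>) powr (-1 - \<epsilon>)))) int_abs_at_top"
    using O by (rule landau_o.bigE)
  then obtain N' where N': "\<And>j. \<bar>j\<bar> \<ge> N' \<Longrightarrow> norm (a j) \<le> C * exp (real_of_int \<bar>j\<bar> * ln (real_of_int \<bar>j\<bar>) powr (-1 - \<epsilon>))"
    unfolding int_abs_at_top_def eventually_filtercomap eventually_at_top_linorder by auto
  define b where "b = (\<lambda>K j. a j * of_real (sinc_coeff (r / 2) j) * of_real (\<Prod>i<K. sinc_coeff (\<eta> i) j ^ (2 ^ i)))"
  have b_le: "norm (b K j) \<le> C / (real_of_int \<bar>j\<bar>)\<^sup>2"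
    if "\<bar>j\<bar> \<ge> int N" "\<bar>j\<bar> \<ge> N'" "int K > \<bar>j\<bar>" for K j
  proof -
    have "norm (b K j) = norm (a j) * \<bar>sinc_coeff (r / 2) j\<bar> * (\<Prod>i<K. \<bar>sinc_coeff (\<eta> i) j\<bar> ^ (2 ^ i))"
      by (simp add: b_def norm_mult abs_prod power_abs flip: of_real_power of_real_prod)
    also have "\<dots> \<le> C * exp (real_of_int \<bar>j\<bar> * ln (real_of_int \<bar>j\<bar>) powr (-1 - \<epsilon>)) * 1 * (\<Prod>i<K. \<bar>sinc_coeff (\<eta> i) j\<bar> ^ (2 ^ i))"
      using C by (intro mult_right_mono mult_mono N' that abs_sinc_coeff_le_1 prod_nonneg) auto
    also have "\<dots> = C * (exp (real_of_int \<bar>j\<bar> * ln (real_of_int \<bar>j\<bar>) powr (-1 - \<epsilon>)) * (\<Prod>i<K. \<bar>sinc_coeff (\<eta> i) j\<bar> ^ (2 ^ i)))"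
      by (simp only: mult_1_right mult.assoc)
    also have "\<dots> \<le> C * (1 / (real_of_int \<bar>j\<bar>)\<^sup>2)"
      using C by (intro mult_left_mono \<eta>(3) that) auto
    finally show ?thesis by simp
  qed
  have "eventually (\<lambda>k. \<forall>K. norm (trig_fun (b K) (n k) x0 - 0) \<le> 1/4) sequentially"
    unfolding b_def
    by (rule averaged_limit[where B = B, OF r \<eta>(1,2)]) (use uv uv' n in \<open>auto simp: I\<close>)
  \<comment> \<open>Frequencies beyond \<open>n k\<close> then satisfy the decay estimate, and
    \<open>n k \<ge> 8 * C\<close> brings the tail \<open>2 * C / n k\<close> below 1/4; the summand
    1 excludes a zero denominator.\<close>
  moreover have "eventually (\<lambda>k. n k \<ge> nat N' + N + nat \<lceil>8 * C\<rceil> + 1) sequentially"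
    using filterlim_subseq[OF n(1)] unfolding filterlim_at_top by blast
  ultimately have "eventually (\<lambda>k. (\<forall>K. norm (trig_fun (b K) (n k) x0 - 0) \<le> 1/4) \<and>
      n k \<ge> nat N' + N + nat \<lceil>8 * C\<rceil> + 1) sequentially"
    by eventually_elim blast
  then obtain k where k: "\<And>K. norm (trig_fun (b K) (n k) x0) \<le> 1/4" "n k \<ge> nat N' + N + nat \<lceil>8 * C\<rceil> + 1"
    by (auto simp: eventually_at_top_linorder)
  have "eventually (\<lambda>l. \<forall>K. norm (trig_fun (b K) (m l) x0 - 1) \<le> 1/4) sequentially"
    unfolding b_def
    by (rule averaged_limit[where B = B', OF r \<eta>(1,2)]) (use uv' m in \<open>auto simp: I\<close>)
  moreover have "eventually (\<lambda>l. m l \<ge> n k) sequentially"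
    using filterlim_subseq[OF m(1)] unfolding filterlim_at_top by blast
  ultimately have "eventually (\<lambda>l. (\<forall>K. norm (trig_fun (b K) (m l) x0 - 1) \<le> 1/4) \<and> m l \<ge> n k) sequentially"
    by eventually_elim blast
  then obtain l where l: "\<And>K. norm (trig_fun (b K) (m l) x0 - 1) \<le> 1/4" "m l \<ge> n k"
    by (auto simp: eventually_at_top_linorder)
  \<comment> \<open>One product length for both partial sums, covering every frequency up to
    \<open>m l\<close>. The estimates above hold for every \<open>K\<close>, so \<open>K\<close> may
    depend on \<open>l\<close> and no infinite product is formed.\<close>
  define K where "K = m l + 1"
  have "norm (trig_fun (b K) (m l) x0 - trig_fun (b K) (n k) x0) \<le> 2 * C * (1 / real (n k) - 1 / real (m l))"
    using C k(2) l(2) by (intro norm_trig_partial_sum_tail_le b_le) (auto simp: K_def)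
  also have "\<dots> \<le> 2 * C * (1 / real (n k))" using C by (intro mult_left_mono) auto
  also have "\<dots> \<le> 1 / 4"
  proof -
    have "8 * C \<le> real (n k)" using k(2) by linarith
    thus ?thesis using k(2) by (simp add: field_simps)
  qed
  finally have "norm (trig_fun (b K) (m l) x0 - trig_fun (b K) (n k) x0) \<le> 1 / 4" .
  moreover have "norm (1 :: complex) \<le> norm (trig_fun (b K) (m l) x0 - trig_fun (b K) (n k) x0) +
      norm (trig_fun (b K) (n k) x0) + norm (trig_fun (b K) (m l) x0 - 1)"
  proof -
    have "1 = (trig_fun (b K) (m l) x0 - trig_fun (b K) (n k) x0) + trig_fun (b K) (n k) x0 - (trig_fun (b K) (m l) x0 - 1)"
      by simp
    thus ?thesis by (metis norm_triangle_ineq4 norm_triangle_ineq add_right_mono order_trans)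
  qed
  ultimately show False using k(1)[of K] l(1)[of K] by simp
qed

theorem corollary1p8:
  shows "(\<exists>a :: int \<Rightarrow> complex. pointwise_universal a \<and>
            (\<lambda>n. norm (a n)) \<in> O[int_abs_at_top](\<lambda>n. exp (real_of_int \<bar>n\<bar> * ln (real_of_int \<bar>n\<bar>) powr (-1)))) \<and>
         (\<forall>\<epsilon>::real. \<epsilon> > 0 \<longrightarrow> (\<forall>a :: int \<Rightarrow> complex.
            (\<lambda>n. norm (a n)) \<in> O[int_abs_at_top](\<lambda>n. exp (real_of_int \<bar>n\<bar> * ln (real_of_int \<bar>n\<bar>) powr (-1 - \<epsilon>)))
            \<longrightarrow> \<not> pointwise_universal a))"
proof (intro conjI allI impI)
  obtain a where a: "pointwise_universal a" "\<And>n. norm (a n) \<le> weight n"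
    using pointwise_universal_exists by blast
  have "(\<lambda>n. norm (a n)) \<in> O[int_abs_at_top](weight)"
    using a(2) by (intro bigoI[of _ 1] always_eventually) (auto simp: less_imp_le[OF weight_pos])
  hence "(\<lambda>n. norm (a n)) \<in> O[int_abs_at_top](\<lambda>n. exp (real_of_int \<bar>n\<bar> * ln (real_of_int \<bar>n\<bar>) powr (-1)))"
    using weight_bigo by (rule landau_o.big_trans)
  with a(1) show "\<exists>a :: int \<Rightarrow> complex. pointwise_universal a \<and>
      (\<lambda>n. norm (a n)) \<in> O[int_abs_at_top](\<lambda>n. exp (real_of_int \<bar>n\<bar> * ln (real_of_int \<bar>n\<bar>) powr (-1)))"
    by blast
qed (rule not_pointwise_universal)

end
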